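(* Let $\mathcal D$ be the mirror Heisenberg–Virasoro algebra, with basis $\{d_m,h_r,\mathbf c,\mathbf l: m\in\mathbb Z, r\in\frac12+\mathbb Z\}$ and brackets $[d_m,d_n]=(m-n)d_{m+n}+\frac{m^3-m}{12}\delta_{m+n,0}\mathbf c$, $[d_m,h_r]=-rh_{m+r}$, $[h_r,h_s]=r\delta_{r+s,0}\mathbf l$, $[\mathbf c,\mathcal D]=[\mathbf l,\mathcal D]=0$. Let $\mathcal H=\mathrm{Span}\{h_r,\mathbf l: r\in\frac12+\mathbb Z\}$ and $\mathfrak p=\mathbb C\mathbf c\oplus\mathcal H$. Let $\phi:\mathfrak p\to\mathbb C$ be a Lie algebra homomorphism with $\phi(\mathcal H)\neq 0$. Then $W(\phi)$ is irreducible if and only if $\phi$ is not an exp-polynomial function.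
   Context: A Lie algebra homomorphism $\phi:\mathfrak p\to\mathbb C$ is a linear map vanishing on $[\mathfrak p,\mathfrak p]=\mathbb C\mathbf l$. $W(\phi)=\mathcal U(\mathcal D)\otimes_{\mathcal U(\mathfrak p)}\mathbb C w_\phi$, where $\mathbb C w_\phi$ is the one-dimensional $\mathfrak p$-module with $pw_\phi=\phi(p)w_\phi$. $\phi$ is called an exp-polynomial function if there exist distinct nonzero complex numbers $a_1,\dots,a_\ell$ and polynomials $f_1,\dots,f_\ell\in\mathbb C[t]$ such that $\phi(h_{\frac12+n})=a_1^nf_1(n)+\dots+a_\ell^nf_\ell(n)$ for all $n\in\mathbb Z$. *)

theory Defs
  imports Complex_Main "HOL-Library.Poly_Mapping" "HOL-Computational_Algebra.Polynomial"
begin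

text \<open>Basis of the mirror Heisenberg-Virasoro algebra:
  D m = d_m, H n = h_(1/2 + n), C = central c, L = central l.\<close>
datatype gen = D int | H int | C | L

text \<open>Tensor algebra T(D) on the basis: finitely supported functions on words.\<close>
type_synonym tens = "gen list \<Rightarrow>\<^sub>0 complex"

definition tmul :: "tens \<Rightarrow> tens \<Rightarrow> tens" where
  "tmul a b = (\<Sum>u\<in>Poly_Mapping.keys a. \<Sum>v\<in>Poly_Mapping.keys b. Poly_Mapping.single (u @ v) (Poly_Mapping.lookup a u * Poly_Mapping.lookup b v))"

definition gvec :: "gen \<Rightarrow> tens" where
  "gvec x = Poly_Mapping.single [x] 1"

definition tscal :: "complex \<Rightarrow> tens" where
  "tscal c = Poly_Mapping.single [] c"

fun br :: "gen \<Rightarrow> gen \<Rightarrow> tens" where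
  "br (D m) (D n) = Poly_Mapping.single [D (m + n)] (of_int (m - n))
      + (if m + n = 0 then Poly_Mapping.single [C] (of_int (m ^ 3 - m) / 12) else 0)"
| "br (D m) (H n) = Poly_Mapping.single [H (m + n)] (- (of_int n + 1/2))"
| "br (H n) (D m) = Poly_Mapping.single [H (m + n)] (of_int n + 1/2)"
| "br (H n) (H k) = (if n + k = -1 then Poly_Mapping.single [L] (of_int n + 1/2) else 0)"
| "br _ _ = 0"

definition left_ideal :: "tens set \<Rightarrow> bool" where
  "left_ideal S \<longleftrightarrow> 0 \<in> S \<and> (\<forall>x\<in>S. \<forall>y\<in>S. x + y \<in> S) \<and> (\<forall>a. \<forall>x\<in>S. tmul a x \<in> S)"

definition in_p :: "gen \<Rightarrow> bool" where
  "in_p x = (case x of D _ \<Rightarrow> False | _ \<Rightarrow> True)"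

text \<open>Generators of the left ideal K with T(D)/K = U(D) \<otimes>_{U(p)} C w_phi:
  the two-sided ideal defining U(D), and p - phi(p) for p in p.
  A linear map phi on p is given by its values on the basis elements H n, C, L.\<close>
definition Wgens :: "(gen \<Rightarrow> complex) \<Rightarrow> tens set" where
  "Wgens \<phi> =
     {tmul (tmul a (tmul (gvec x) (gvec y) - tmul (gvec y) (gvec x) - br x y)) b | a b x y. True}
     \<union> {gvec p - tscal (\<phi> p) | p. in_p p}"

definition Wker :: "(gen \<Rightarrow> complex) \<Rightarrow> tens set" where
  "Wker \<phi> = \<Inter>{S. left_ideal S \<and> Wgens \<phi> \<subseteq> S}"

text \<open>W(phi) = T(D)/Wker phi is irreducible: nonzero, and its only D-submodules
  (= left ideals of T(D) containing Wker phi) are trivial.\<close>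
definition W_irreducible :: "(gen \<Rightarrow> complex) \<Rightarrow> bool" where
  "W_irreducible \<phi> \<longleftrightarrow> Wker \<phi> \<noteq> UNIV \<and>
     (\<forall>S. left_ideal S \<and> Wker \<phi> \<subseteq> S \<longrightarrow> S = Wker \<phi> \<or> S = UNIV)"

definition exp_polynomial :: "(gen \<Rightarrow> complex) \<Rightarrow> bool" where
  "exp_polynomial \<phi> \<longleftrightarrow> (\<exists>A (f :: complex \<Rightarrow> complex poly). finite A \<and> 0 \<notin> A \<and>
     (\<forall>n::int. \<phi> (H n) = (\<Sum>a\<in>A. a powi n * poly (f a) (of_int n))))"

end

theory Submission
  imports Defs
    "HOL-Computational_Algebra.Fundamental_Theorem_Algebra"
    "HOL-Library.Function_Algebras"
begin

text \<open>
  The sequence \<open>\<phi> (H n)\<close> is exp-polynomial iff it satisfies a linear recurrence, that is, iff some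
  \<open>v = \<Sum>c\<^sub>m d\<^sub>m \<noteq> 0\<close> has \<open>\<Sum>c\<^sub>m \<phi> (H (m + n)) = 0\<close> for all \<open>n\<close>; and since \<open>[h\<^sub>r, v] = r \<Sum>c\<^sub>m h\<^bsub>m+r\<^esub>\<close>,
  the latter means that \<open>\<phi>\<close> extends to a character of the subalgebra \<open>\<complex>v + \<pp>\<close>, with an arbitrary
  value on \<open>v\<close>.

  By the Poincare-Birkhoff-Witt theorem, a character of a subalgebra induces a nonzero module. If
  there is such a \<open>v\<close>, the modules induced from the extensions of \<open>\<phi>\<close> with \<open>v \<mapsto> 0\<close> and \<open>v \<mapsto> 1\<close> are
  nonzero quotients of \<open>W(\<phi>)\<close> with different kernels, so \<open>W(\<phi>)\<close> is reducible.

  If there is none, filter \<open>W(\<phi>)\<close> by the number of letters \<open>d\<^sub>m\<close>. The operators \<open>h\<^sub>r - \<phi>(h\<^sub>r)\<close>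
  lower the degree and act on symbols as the derivations \<open>d\<^sub>m \<mapsto> r \<phi>(h\<^bsub>m+r\<^esub>)\<close>. On finitely many
  letters these span all derivations with constant coefficients, so Euler's operator
  \<open>\<Sum>d\<^sub>m \<partial>\<^sub>m\<close> is available. It multiplies a symbol of degree \<open>k\<close> by \<open>k\<close>, and it annihilates the
  vectors killed by all \<open>h\<^sub>r - \<phi>(h\<^sub>r)\<close>, which therefore have degree 0; and every nonzero submodule
  contains such a vector.
\<close>

section \<open>Vector spaces of functions and of formal linear combinations\<close>

definition fun_scale :: "'a::field \<Rightarrow> ('i \<Rightarrow> 'a) \<Rightarrow> 'i \<Rightarrow> 'a" where
  "fun_scale c f = (\<lambda>i. c * f i)"

lemma fun_scale_apply [simp]: "fun_scale c f i = c * f i"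
  by (simp add: fun_scale_def)

global_interpretation fn: vector_space fun_scale
  by unfold_locales (simp_all add: fun_eq_iff algebra_simps)

lemma vector_space_field: "vector_space ((*) :: 'a::field \<Rightarrow> 'a \<Rightarrow> 'a)"
  by unfold_locales (simp_all add: algebra_simps)

abbreviation lookup where "lookup \<equiv> Poly_Mapping.lookup"
abbreviation keys where "keys \<equiv> Poly_Mapping.keys"
abbreviation single where "single \<equiv> Poly_Mapping.single"

definition pm_scale :: "'a::field \<Rightarrow> ('i \<Rightarrow>\<^sub>0 'a) \<Rightarrow> 'i \<Rightarrow>\<^sub>0 'a" (infixr \<open>\<cdot>\<close> 75) where
  "c \<cdot> x = Poly_Mapping.map ((*) c) x"

lemma lookup_pm_scale [simp]: "lookup (c \<cdot> x) i = c * lookup x i"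
  by (simp add: pm_scale_def map.rep_eq when_def)

lemma pm_scale_single [simp]: "c \<cdot> single i a = single i (c * a)"
  by (rule poly_mapping_eqI) (simp add: lookup_single when_def)

global_interpretation pm: vector_space pm_scale
  by unfold_locales (rule poly_mapping_eqI; simp add: lookup_add algebra_simps)+

lemma keys_pm_scale: "keys (c \<cdot> x) \<subseteq> keys x"
  by (auto simp: in_keys_iff)

lemma pm_subspace_keys_subset: "pm.subspace {x. keys x \<subseteq> A}"
proof (rule pm.subspaceI)
  show "0 \<in> {x. keys x \<subseteq> A}" by simp
  show "x + y \<in> {x. keys x \<subseteq> A}" if "x \<in> {x. keys x \<subseteq> A}" "y \<in> {x. keys x \<subseteq> A}" for x y
    using that keys_add[of x y] by blast
  show "c \<cdot> x \<in> {x. keys x \<subseteq> A}" if "x \<in> {x. keys x \<subseteq> A}" for c x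
    using that keys_pm_scale[of c x] by blast
qed

lemma sum_single_lookup: "(\<Sum>i\<in>keys x. single i (lookup x i)) = x"
  by (rule poly_mapping_eqI) (auto simp: lookup_sum lookup_single when_def in_keys_iff)

lemma span_range_single: "pm.span (range (\<lambda>i :: 'i. single i (1 :: 'a::field))) = UNIV"
proof -
  have "single i a \<in> pm.span (range (\<lambda>i. single i 1))" for i :: 'i and a :: 'a
    using pm.span_scale[OF pm.span_base, of "single i 1" "range (\<lambda>i. single i 1)" a] by simp
  then have "x \<in> pm.span (range (\<lambda>i. single i 1))" for x :: "'i \<Rightarrow>\<^sub>0 'a"
    using pm.span_sum[of "keys x" "\<lambda>i. single i (lookup x i)"] by (simp add: sum_single_lookup)
  then show ?thesis by blast
qed

definition lin_ext :: "('a::field \<Rightarrow> 'b::ab_group_add \<Rightarrow> 'b) \<Rightarrow> ('i \<Rightarrow> 'b) \<Rightarrow> ('i \<Rightarrow>\<^sub>0 'a) \<Rightarrow> 'b" where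
  "lin_ext s f x = (\<Sum>i\<in>keys x. s (lookup x i) (f i))"

lemma lin_ext_cong: "(\<And>i. i \<in> keys x \<Longrightarrow> f i = g i) \<Longrightarrow> lin_ext s f x = lin_ext s g x"
  by (simp add: lin_ext_def)

context vector_space
begin

lemma subspace_scale_iff:
  assumes "subspace S" "c \<noteq> 0"
  shows "scale c x \<in> S \<longleftrightarrow> x \<in> S"
proof
  assume "scale c x \<in> S"
  then have "scale (inverse c) (scale c x) \<in> S" using assms(1) by (rule subspace_scale[rotated])
  then show "x \<in> S" using assms(2) by simp
qed (rule subspace_scale[OF assms(1)])

lemma lin_ext_superset:
  "finite A \<Longrightarrow> keys x \<subseteq> A \<Longrightarrow> lin_ext scale f x = (\<Sum>i\<in>A. scale (lookup x i) (f i))"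
  unfolding lin_ext_def by (intro sum.mono_neutral_left) (auto simp: in_keys_iff)

lemma lin_ext_single [simp]: "lin_ext scale f (single i a) = scale a (f i)"
  by (simp add: lin_ext_def)

lemma linear_lin_ext:
  fixes f :: "'i \<Rightarrow> 'b"
  shows "Vector_Spaces.linear pm_scale scale (lin_ext scale f)"
proof unfold_locales
  fix x y :: "'i \<Rightarrow>\<^sub>0 'a"
  have "lin_ext scale f z = (\<Sum>i\<in>keys x \<union> keys y. scale (lookup z i) (f i))"
    if "keys z \<subseteq> keys x \<union> keys y" for z
    using that by (intro lin_ext_superset) auto
  then show "lin_ext scale f (x + y) = lin_ext scale f x + lin_ext scale f y"
    using keys_add[of x y] by (simp add: lookup_add scale_left_distrib sum.distrib)
next
  fix c x
  have "lin_ext scale f (c \<cdot> x) = (\<Sum>i\<in>keys x. scale (lookup (c \<cdot> x) i) (f i))"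
    by (intro lin_ext_superset keys_pm_scale) simp
  then show "lin_ext scale f (c \<cdot> x) = scale c (lin_ext scale f x)"
    by (simp add: lin_ext_def scale_sum_right)
qed

lemma lin_ext_zero [simp]: "lin_ext scale f 0 = 0"
  by (simp add: lin_ext_def)

lemma lin_ext_add: "lin_ext scale f (x + y) = lin_ext scale f x + lin_ext scale f y"
  using linear_lin_ext[of f] by (simp add: Vector_Spaces.linear_iff)

lemma lin_ext_scale: "lin_ext scale f (c \<cdot> x) = scale c (lin_ext scale f x)"
  using linear_lin_ext[of f] by (simp add: Vector_Spaces.linear_iff)

lemma linear_lin_ext_fun:
  assumes "\<And>i. Vector_Spaces.linear s scale (\<lambda>y. f y i)"
  shows "Vector_Spaces.linear s scale (\<lambda>y. lin_ext scale (f y) x)"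
proof -
  interpret s: Vector_Spaces.linear s scale "\<lambda>y. f y i" for i by fact
  show ?thesis
    by unfold_locales
      (simp_all add: lin_ext_def s.add s.scale scale_right_distrib sum.distrib scale_sum_right
        mult.commute)
qed

lemma lin_ext_in_subspace:
  "subspace S \<Longrightarrow> (\<And>i. i \<in> keys x \<Longrightarrow> f i \<in> S) \<Longrightarrow> lin_ext scale f x \<in> S"
  unfolding lin_ext_def by (intro subspace_sum subspace_scale)

end

lemma keys_lin_ext_subset:
  "(\<And>i. i \<in> keys x \<Longrightarrow> keys (f i) \<subseteq> A) \<Longrightarrow> keys (lin_ext pm_scale f x) \<subseteq> A"
  using pm.lin_ext_in_subspace[OF pm_subspace_keys_subset, of x f A] by simp

lemma linear_eq_on_single:
  assumes "Vector_Spaces.linear pm_scale s f" "Vector_Spaces.linear pm_scale s g"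
    and "\<And>i. f (single i 1) = g (single i 1)"
  shows "f x = g x"
proof -
  interpret f: Vector_Spaces.linear pm_scale s f by fact
  interpret vector_space_pair pm_scale s ..
  show ?thesis
    by (rule linear_eq_on[OF assms(1,2), of _ "range (\<lambda>i. single i 1)"])
      (auto simp: span_range_single assms(3))
qed

abbreviation unit_fun :: "'i \<Rightarrow> 'i \<Rightarrow> 'a::zero_neq_one" where
  "unit_fun i \<equiv> (\<lambda>j. if j = i then 1 else 0)"

lemma linear_form_on_supported:
  fixes g :: "('i \<Rightarrow> 'a::field) \<Rightarrow> 'a"
  assumes g: "Vector_Spaces.linear fun_scale (*) g"
    and J: "finite J" and f: "\<And>i. i \<notin> J \<Longrightarrow> f i = 0"
  shows "g f = (\<Sum>i\<in>J. g (unit_fun i) * f i)"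
proof -
  interpret Vector_Spaces.linear fun_scale "(*)" g by (rule g)
  have "f = (\<Sum>i\<in>J. fun_scale (f i) (unit_fun i))"
  proof
    fix j
    have "(\<Sum>i\<in>J. fun_scale (f i) (unit_fun i)) j = (\<Sum>i\<in>J. if j = i then f i else 0)"
      by (induction J rule: infinite_finite_induct) simp_all
    then show "f j = (\<Sum>i\<in>J. fun_scale (f i) (unit_fun i)) j" using f[of j] J by auto
  qed
  then have "g f = g (\<Sum>i\<in>J. fun_scale (f i) (unit_fun i))" by (rule arg_cong)
  then show ?thesis by (simp add: sum scale mult.commute)
qed

lemma supported_in_span_if_no_annihilator:
  fixes F :: "('i \<Rightarrow> 'a::field) set"
  assumes J: "finite J" and F: "\<And>f i. f \<in> F \<Longrightarrow> i \<notin> J \<Longrightarrow> f i = 0"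
    and no_annihilator: "\<And>c. (\<And>f. f \<in> F \<Longrightarrow> (\<Sum>i\<in>J. c i * f i) = 0) \<Longrightarrow> \<forall>i\<in>J. c i = 0"
    and h: "\<And>i. i \<notin> J \<Longrightarrow> h i = 0"
  shows "h \<in> fn.span F"
proof (rule ccontr)
  assume h_notin: "h \<notin> fn.span F"
  obtain B where B: "B \<subseteq> F" "fn.independent B" "F \<subseteq> fn.span B"
    using fn.maximal_independent_subset[of F] by blast
  have "fn.span B \<subseteq> fn.span F" using B(1) by (rule fn.span_mono)
  interpret pair: vector_space_pair fun_scale "(*) :: 'a \<Rightarrow> 'a \<Rightarrow> 'a"
    using vector_space_field by (intro vector_space_pair.intro fn.vector_space_axioms)
  have "fn.independent (insert h B)"
    using h_notin \<open>fn.span B \<subseteq> fn.span F\<close> B(2) by (intro fn.independent_insertI) auto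
  then obtain g where g: "Vector_Spaces.linear fun_scale (*) g"
      "\<forall>f\<in>insert h B. g f = (if f = h then 1 else 0)"
    using pair.linear_independent_extend[of "insert h B" "\<lambda>f. if f = h then 1 else 0"] by blast
  interpret g: Vector_Spaces.linear fun_scale "(*)" g by (rule g(1))
  have "h \<notin> B" using h_notin B(1) fn.span_base by blast
  then have "g b = 0" if "b \<in> B" for b using g(2) that by auto
  then have "g f = 0" if "f \<in> F" for f using g.eq_0_on_span that B(3) by blast
  then have "(\<Sum>i\<in>J. g (unit_fun i) * f i) = 0" if "f \<in> F" for f
    using linear_form_on_supported[OF g(1) J, of f] F that by simp
  then have "\<forall>i\<in>J. g (unit_fun i) = 0" by (rule no_annihilator)
  then have "g h = 0" using linear_form_on_supported[OF g(1) J, of h] h by simp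
  then show False using g(2) by simp
qed

section \<open>Linear recurrences and exponential polynomials\<close>

definition shift_op :: "'a::comm_ring_1 poly \<Rightarrow> (int \<Rightarrow> 'a) \<Rightarrow> int \<Rightarrow> 'a" where
  "shift_op p s = fold_coeffs (\<lambda>a f n. a * s n + f (n + 1)) p (\<lambda>n. 0)"

lemma shift_op_0 [simp]: "shift_op 0 s = 0"
  by (simp add: shift_op_def zero_fun_def)

lemma shift_op_pCons [simp]:
  "shift_op (pCons a p) s n = a * s n + shift_op p s (n + 1)"
  by (cases "p = 0 \<and> a = 0") (auto simp: shift_op_def)

lemma shift_op_add: "shift_op (p + q) s n = shift_op p s n + shift_op q s n"
proof (induction p arbitrary: q n)
  case (pCons a p)
  obtain b r where "q = pCons b r" by (cases q)
  then show ?case using pCons.IH[of r "n + 1"] by (simp add: algebra_simps)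
qed simp

lemma shift_op_smult: "shift_op (smult c p) s n = c * shift_op p s n"
  by (induction p arbitrary: n) (auto simp: algebra_simps)

lemma shift_op_sum: "shift_op (sum p A) s n = (\<Sum>i\<in>A. shift_op (p i) s n)"
  by (induction A rule: infinite_finite_induct) (auto simp: shift_op_add)

lemma shift_op_monom: "shift_op (monom c k) s n = c * s (n + int k)"
  by (induction k arbitrary: n) (auto simp: monom_0 monom_Suc algebra_simps)

lemma shift_op_mult: "shift_op (p * q) s = shift_op p (shift_op q s)"
proof
  show "shift_op (p * q) s n = shift_op p (shift_op q s) n" for n
    by (induction p arbitrary: n) (auto simp: shift_op_add shift_op_smult)
qed

lemma shift_op_conv_sum: "shift_op p s n = (\<Sum>i\<le>degree p. coeff p i * s (n + int i))"
proof -
  have "shift_op p s n = shift_op (\<Sum>i\<le>degree p. monom (coeff p i) i) s n"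
    by (simp add: poly_as_sum_of_monoms)
  then show ?thesis by (simp only: shift_op_sum shift_op_monom)
qed

lemma shift_op_zero_seq [simp]: "shift_op p 0 = 0"
  by (simp add: fun_eq_iff shift_op_conv_sum)

lemma shift_op_seq_add: "shift_op p (s + t) n = shift_op p s n + shift_op p t n"
  by (simp add: shift_op_conv_sum distrib_left sum.distrib)

lemma shift_op_seq_scale: "shift_op p (fun_scale c s) n = c * shift_op p s n"
  by (induction p arbitrary: n) (simp_all add: algebra_simps)

text \<open>The commutator of \<open>p(E)\<close>, for the shift \<open>E\<close>, and multiplication by \<open>n\<close> is \<open>E p'(E)\<close>.\<close>
lemma shift_op_times_index:
  "shift_op p (\<lambda>n. of_int n * s n) n = of_int n * shift_op p s n + shift_op (pCons 0 (pderiv p)) s n"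
  by (induction p arbitrary: n) (simp_all add: pderiv_pCons shift_op_add algebra_simps)

definition recurrent :: "(int \<Rightarrow> 'a::comm_ring_1) \<Rightarrow> bool" where
  "recurrent s \<longleftrightarrow> (\<exists>p. p \<noteq> 0 \<and> shift_op p s = 0)"

lemma recurrent_if_annihilated:
  fixes s :: "int \<Rightarrow> 'a::comm_ring_1"
  assumes J: "finite J" and i: "i \<in> J" "c i \<noteq> 0" and annihilated: "\<And>n. (\<Sum>m\<in>J. c m * s (m + n)) = 0"
  shows "recurrent s"
proof -
  have Min: "Min J \<le> m" if "m \<in> J" for m using that J by simp
  define p where "p = (\<Sum>m\<in>J. monom (c m) (nat (m - Min J)))"
  have "coeff p (nat (i - Min J)) = (\<Sum>m\<in>J. if m = i then c i else 0)"
    unfolding p_def coeff_sum coeff_monom using i(1) Min by (intro sum.cong) (auto simp: nat_eq_iff)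
  then have "p \<noteq> 0" using i J by auto
  moreover have "shift_op p s n = 0" for n
  proof -
    have "shift_op p s n = (\<Sum>m\<in>J. c m * s (m + (n - Min J)))"
      unfolding p_def shift_op_sum shift_op_monom using Min
      by (intro sum.cong) (auto simp: algebra_simps)
    then show ?thesis by (simp only: annihilated)
  qed
  ultimately show ?thesis by (auto simp: recurrent_def fun_eq_iff)
qed

lemma subspace_recurrent: "fn.subspace {s :: int \<Rightarrow> 'a::field. recurrent s}"
proof (rule fn.subspaceI)
  show "0 \<in> {s. recurrent s}" by (auto simp: recurrent_def intro: exI[of _ 1])
next
  fix s t :: "int \<Rightarrow> 'a"
  assume "s \<in> {s. recurrent s}" "t \<in> {s. recurrent s}"
  then obtain p q where pq: "p \<noteq> 0" "shift_op p s = 0" "q \<noteq> 0" "shift_op q t = 0"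
    by (auto simp: recurrent_def)
  have "shift_op (p * q) (s + t) n = shift_op (q * p) s n + shift_op (p * q) t n" for n
    by (simp add: shift_op_seq_add mult.commute)
  then have "shift_op (p * q) (s + t) = 0"
    by (simp add: fun_eq_iff shift_op_mult pq)
  with pq show "s + t \<in> {s. recurrent s}" by (auto simp: recurrent_def intro!: exI[of _ "p * q"])
next
  show "fun_scale c s \<in> {s. recurrent s}" if "s \<in> {s. recurrent s}" for c and s :: "int \<Rightarrow> 'a"
    using that by (auto simp: recurrent_def fun_eq_iff shift_op_seq_scale)
qed

lemma recurrent_times_index:
  fixes s :: "int \<Rightarrow> 'a::field"
  assumes "recurrent s"
  shows "recurrent (\<lambda>n. of_int n * s n)"
proof -
  obtain p where p: "p \<noteq> 0" "shift_op p s = 0"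
    using assms by (auto simp: recurrent_def)
  have square: "pCons 0 (pderiv (p * p)) = (pCons 0 (pderiv p) + pCons 0 (pderiv p)) * p"
    by (simp add: pderiv_mult algebra_simps)
  have "shift_op (p * p) (\<lambda>n. of_int n * s n) n = 0" for n
    unfolding shift_op_times_index square unfolding shift_op_mult p(2) by simp
  with p(1) show ?thesis by (auto simp: recurrent_def fun_eq_iff intro!: exI[of _ "p * p"])
qed

lemma recurrent_powi_times_poly:
  fixes a :: "'a::field"
  assumes "a \<noteq> 0"
  shows "recurrent (\<lambda>n. a powi n * poly f (of_int n))"
proof (induction f)
  case 0
  show ?case using fn.subspace_0[OF subspace_recurrent] by (simp add: zero_fun_def)
next
  case (pCons c f)
  have "shift_op [:-a, 1:] (\<lambda>n. a powi n) = 0"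
    using assms by (simp add: fun_eq_iff power_int_add)
  then have "recurrent (\<lambda>n. a powi n)"
    unfolding recurrent_def by (intro exI[of _ "[:-a, 1:]"]) simp
  then have "recurrent (fun_scale c (\<lambda>n. a powi n))"
    using fn.subspace_scale[OF subspace_recurrent] by simp
  then have "recurrent (fun_scale c (\<lambda>n. a powi n) + (\<lambda>n. of_int n * (a powi n * poly f (of_int n))))"
    using recurrent_times_index[OF pCons.IH] fn.subspace_add[OF subspace_recurrent] by simp
  then show ?case by (simp add: plus_fun_def fun_scale_def algebra_simps)
qed

definition exp_poly_seq :: "(int \<Rightarrow> 'a::field) \<Rightarrow> bool" where
  "exp_poly_seq s \<longleftrightarrow> (\<exists>A f. finite A \<and> 0 \<notin> A \<and>
     (\<forall>n. s n = (\<Sum>a\<in>A. a powi n * poly (f a) (of_int n))))"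

lemma exp_poly_seq_imp_recurrent:
  assumes "exp_poly_seq s"
  shows "recurrent s"
proof -
  obtain A f where A: "finite A" "0 \<notin> A" "\<And>n. s n = (\<Sum>a\<in>A. a powi n * poly (f a) (of_int n))"
    using assms by (auto simp: exp_poly_seq_def)
  have "(\<Sum>a\<in>A. (\<lambda>n. a powi n * poly (f a) (of_int n))) \<in> {s. recurrent s}"
    using A by (intro fn.subspace_sum subspace_recurrent) (auto intro: recurrent_powi_times_poly)
  moreover have "s = (\<Sum>a\<in>A. (\<lambda>n. a powi n * poly (f a) (of_int n)))"
    using A(1) by (simp add: fun_eq_iff A(3)) (induction A rule: finite_induct; simp)
  ultimately show ?thesis by simp
qed

lemma subspace_exp_poly_seq: "fn.subspace {s :: int \<Rightarrow> 'a::field. exp_poly_seq s}"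
proof (rule fn.subspaceI)
  show "0 \<in> {s. exp_poly_seq s}" by (auto simp: exp_poly_seq_def intro: exI[of _ "{}"])
next
  fix s t :: "int \<Rightarrow> 'a"
  assume "s \<in> {s. exp_poly_seq s}" "t \<in> {s. exp_poly_seq s}"
  then obtain A f B g where A: "finite A" "0 \<notin> A"
      and s: "\<And>n. s n = (\<Sum>a\<in>A. a powi n * poly (f a) (of_int n))"
    and B: "finite B" "0 \<notin> B" and t: "\<And>n. t n = (\<Sum>a\<in>B. a powi n * poly (g a) (of_int n))"
    unfolding exp_poly_seq_def by blast
  let ?f = "\<lambda>a. if a \<in> A then f a else 0" and ?g = "\<lambda>a. if a \<in> B then g a else 0"
  have "(s + t) n = (\<Sum>a\<in>A \<union> B. a powi n * poly (?f a + ?g a) (of_int n))" for n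
  proof -
    have "s n = (\<Sum>a\<in>A \<union> B. a powi n * poly (?f a) (of_int n))"
      unfolding s using A B by (intro sum.mono_neutral_cong_left) auto
    moreover have "t n = (\<Sum>a\<in>A \<union> B. a powi n * poly (?g a) (of_int n))"
      unfolding t using A B by (intro sum.mono_neutral_cong_left) auto
    ultimately show ?thesis by (simp add: sum.distrib distrib_left)
  qed
  then show "s + t \<in> {s. exp_poly_seq s}"
    using A B by (auto simp: exp_poly_seq_def intro!: exI[of _ "A \<union> B"] exI[of _ "\<lambda>a. ?f a + ?g a"])
next
  fix c and s :: "int \<Rightarrow> 'a"
  assume "s \<in> {s. exp_poly_seq s}"
  then obtain A f where A: "finite A" "0 \<notin> A" "\<And>n. s n = (\<Sum>a\<in>A. a powi n * poly (f a) (of_int n))"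
    unfolding exp_poly_seq_def by blast
  then show "fun_scale c s \<in> {s. exp_poly_seq s}"
    by (auto simp: exp_poly_seq_def sum_distrib_left algebra_simps
        intro!: exI[of _ A] exI[of _ "\<lambda>a. smult c (f a)"])
qed

definition exp_binomial :: "'a::field_char_0 \<Rightarrow> nat \<Rightarrow> int \<Rightarrow> 'a" where
  "exp_binomial b k n = b powi n * (of_int n gchoose k)"

abbreviation exp_binomials :: "(int \<Rightarrow> 'a::field_char_0) set" where
  "exp_binomials \<equiv> {exp_binomial b k | b k. b \<noteq> 0}"

lemma exp_poly_seq_exp_binomial:
  assumes "b \<noteq> 0"
  shows "exp_poly_seq (exp_binomial b k)"
proof -
  have "poly (smult (inverse (fact k)) (\<Prod>i<k. [:- of_nat i, 1:])) x = x gchoose k" for x :: 'a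
    by (simp add: poly_prod gbinomial_prod_rev atLeast0LessThan field_simps)
  then show ?thesis
    using assms unfolding exp_poly_seq_def exp_binomial_def
    by (intro exI[of _ "{b}"] exI[of _ "\<lambda>_. smult (inverse (fact k)) (\<Prod>i<k. [:- of_nat i, 1:])"]) auto
qed

abbreviation shift_minus :: "'a::field \<Rightarrow> (int \<Rightarrow> 'a) \<Rightarrow> int \<Rightarrow> 'a" where
  "shift_minus a \<equiv> shift_op [:- a, 1:]"

lemma linear_shift_minus: "Vector_Spaces.linear fun_scale fun_scale (shift_minus a)"
  by unfold_locales (simp_all add: fun_eq_iff algebra_simps)

lemma shift_minus_exp_binomial_0:
  "b \<noteq> 0 \<Longrightarrow> shift_minus a (exp_binomial b 0) = fun_scale (b - a) (exp_binomial b 0)"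
  by (simp add: fun_eq_iff exp_binomial_def power_int_add algebra_simps)

lemma shift_minus_exp_binomial_Suc:
  fixes b :: "'a::field_char_0"
  assumes "b \<noteq> 0"
  shows "shift_minus a (exp_binomial b (Suc k))
    = fun_scale (b - a) (exp_binomial b (Suc k)) + fun_scale b (exp_binomial b k)"
proof
  fix n
  show "shift_minus a (exp_binomial b (Suc k)) n
    = (fun_scale (b - a) (exp_binomial b (Suc k)) + fun_scale b (exp_binomial b k)) n"
    using assms gbinomial_Suc_Suc[of "of_int n :: 'a" k]
    by (simp add: exp_binomial_def power_int_add algebra_simps)
qed

lemma span_exp_binomials_subset_image_shift_minus:
  fixes a :: "'a::field_char_0"
  assumes "a \<noteq> 0"
  shows "fn.span exp_binomials \<subseteq> shift_minus a ` fn.span exp_binomials"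
proof -
  interpret Vector_Spaces.linear fun_scale fun_scale "shift_minus a" by (rule linear_shift_minus)
  define R where "R = shift_minus a ` fn.span exp_binomials"
  have R: "fn.subspace R" unfolding R_def by (rule subspace_image) simp
  have image: "shift_minus a (exp_binomial b k) \<in> R" if "b \<noteq> 0" for b k
    unfolding R_def using that by (intro imageI fn.span_base) auto
  have "exp_binomial b k \<in> R" if b: "b \<noteq> 0" for b k
  proof (cases "b = a")
    case True
    then have "fun_scale a (exp_binomial b k) \<in> R"
      using image[of b "Suc k"] shift_minus_exp_binomial_Suc[of b a k] b
      by (simp add: fn.scale_zero_left)
    then show ?thesis using fn.subspace_scale_iff[OF R assms] by blast
  next
    case False
    then have unscale: "exp_binomial b j \<in> R" if "fun_scale (b - a) (exp_binomial b j) \<in> R" for j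
      using that fn.subspace_scale_iff[OF R, of "b - a"] by simp
    show ?thesis
    proof (induction k)
      case 0
      show ?case using image[of b 0] b by (intro unscale) (simp add: shift_minus_exp_binomial_0)
    next
      case (Suc k)
      have "fun_scale (b - a) (exp_binomial b (Suc k))
          = shift_minus a (exp_binomial b (Suc k)) - fun_scale b (exp_binomial b k)"
        using b by (simp add: shift_minus_exp_binomial_Suc del: shift_op_pCons)
      also have "\<dots> \<in> R" using R image[OF b] Suc.IH by (intro fn.subspace_diff fn.subspace_scale)
      finally show ?case by (rule unscale)
    qed
  qed
  then have "fn.span exp_binomials \<subseteq> R" using R by (intro fn.span_minimal) auto
  then show ?thesis unfolding R_def .
qed

lemma shift_minus_kernel_subset_span_exp_binomials:
  fixes s :: "int \<Rightarrow> 'a::field_char_0"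
  assumes "a \<noteq> 0" "shift_minus a s = 0"
  shows "s \<in> fn.span exp_binomials"
proof -
  have step: "s (n + 1) = a * s n" for n
    using fun_cong[OF assms(2), of n] by (simp add: eq_neg_iff_add_eq_0)
  have "s n = s 0 * a powi n" for n
  proof (induction n rule: int_induct[of _ 0])
    case (step2 n)
    then show ?case using assms(1) step[of "n - 1"] by (simp add: power_int_diff field_simps)
  qed (use assms(1) in \<open>simp_all add: step power_int_add\<close>)
  then obtain c where "\<And>n. s n = c * a powi n" by blast
  then have "s = fun_scale c (exp_binomial a 0)" by (simp add: fun_eq_iff exp_binomial_def)
  moreover have "fun_scale c (exp_binomial a 0) \<in> fn.span exp_binomials"
    using assms(1) by (intro fn.span_scale fn.span_base) auto
  ultimately show ?thesis by (simp only:)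
qed

lemma in_span_exp_binomials_if_shift_minus:
  fixes s :: "int \<Rightarrow> 'a::field_char_0"
  assumes a: "a \<noteq> 0" and "shift_minus a s \<in> fn.span exp_binomials"
  shows "s \<in> fn.span exp_binomials"
proof -
  interpret Vector_Spaces.linear fun_scale fun_scale "shift_minus a" by (rule linear_shift_minus)
  have "shift_minus a s \<in> shift_minus a ` fn.span exp_binomials"
    using assms(2) by (rule subsetD[OF span_exp_binomials_subset_image_shift_minus[OF a]])
  then obtain g where g: "shift_minus a s = shift_minus a g" "g \<in> fn.span exp_binomials"
    by (rule imageE)
  have "shift_minus a (s - g) = 0" unfolding diff g(1) by simp
  then have "s - g \<in> fn.span exp_binomials"
    by (rule shift_minus_kernel_subset_span_exp_binomials[OF a])
  then have "(s - g) + g \<in> fn.span exp_binomials" using g(2) by (rule fn.span_add)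
  then show ?thesis by simp
qed

lemma recurrent_imp_in_span_exp_binomials:
  fixes s :: "int \<Rightarrow> 'a::{alg_closed_field, field_char_0}"
  assumes "recurrent s"
  shows "s \<in> fn.span exp_binomials"
proof -
  obtain p where "p \<noteq> 0" "shift_op p s = 0" using assms by (auto simp: recurrent_def)
  then show ?thesis
  proof (induction "degree p" arbitrary: p s)
    case 0
    then obtain c where "p = [:c:]" by (metis degree_eq_zeroE)
    with 0 have "s = 0" by (auto simp: fun_eq_iff)
    then show ?case by (simp only: fn.span_zero)
  next
    case (Suc d)
    then obtain a where "poly p a = 0" using alg_closed_imp_poly_has_root[of p] by auto
    then obtain q where p: "p = q * [:- a, 1:]" by (metis poly_eq_0_iff_dvd dvdE mult.commute)
    then have q: "q \<noteq> 0" using Suc.prems(1) by auto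
    have "degree p = degree q + 1" unfolding p using q by (subst degree_mult_eq) auto
    then have degree: "d = degree q" using Suc.hyps(2) by simp
    show ?case
    proof (cases "a = 0")
      case True
      then have "shift_op q s (n + 1) = 0" for n
        using fun_cong[OF Suc.prems(2), of n] by (simp add: p)
      then have "shift_op q s = 0" by (metis diff_add_cancel ext zero_fun_apply)
      then show ?thesis using Suc.hyps(1) degree q by blast
    next
      case False
      have "shift_op q (shift_minus a s) = 0"
        using Suc.prems(2) by (simp only: p shift_op_mult)
      then have "shift_minus a s \<in> fn.span exp_binomials"
        by (rule Suc.hyps(1)[OF degree q])
      then show ?thesis by (rule in_span_exp_binomials_if_shift_minus[OF False])
    qed
  qed
qed

theorem exp_poly_seq_iff_recurrent:
  fixes s :: "int \<Rightarrow> 'a::{alg_closed_field, field_char_0}"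
  shows "exp_poly_seq s \<longleftrightarrow> recurrent s"
proof
  have "fn.span exp_binomials \<subseteq> {s :: int \<Rightarrow> 'a. exp_poly_seq s}"
    by (intro fn.span_minimal subspace_exp_poly_seq) (auto intro: exp_poly_seq_exp_binomial)
  then show "exp_poly_seq s" if "recurrent s"
    using recurrent_imp_in_span_exp_binomials[OF that] by blast
qed (rule exp_poly_seq_imp_recurrent)

section \<open>Modules induced from a character of a subalgebra\<close>

locale lie_algebra = vector_space scale
  for scale :: "'k::field \<Rightarrow> 'v::ab_group_add \<Rightarrow> 'v" +
  fixes bracket :: "'v \<Rightarrow> 'v \<Rightarrow> 'v"
  assumes linear_bracket_right: "Vector_Spaces.linear scale scale (bracket x)"
    and linear_bracket_left: "Vector_Spaces.linear scale scale (\<lambda>x. bracket x y)"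
    and bracket_self: "bracket x x = 0"
    and jacobi: "bracket x (bracket y z) + bracket y (bracket z x) + bracket z (bracket x y) = 0"
begin

sublocale bracket_right: Vector_Spaces.linear scale scale "bracket x" for x
  by (rule linear_bracket_right)

sublocale bracket_left: Vector_Spaces.linear scale scale "\<lambda>x. bracket x y" for y
  by (rule linear_bracket_left)

lemma bracket_antisym: "bracket y x = - bracket x y"
proof -
  have "bracket (x + y) (x + y) = bracket x y + bracket y x"
    unfolding bracket_right.add bracket_left.add by (simp add: bracket_self)
  then have "bracket x y + bracket y x = 0" by (simp only: bracket_self)
  then show ?thesis by (rule minus_unique[symmetric])
qed

lemma bracket_insert_in_subspace:
  assumes S: "subspace S" and Q: "\<And>x y. x \<in> Q \<Longrightarrow> y \<in> Q \<Longrightarrow> bracket x y \<in> S"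
    and v: "\<And>x. x \<in> Q \<Longrightarrow> bracket x v \<in> S" and xy: "x \<in> insert v Q" "y \<in> insert v Q"
  shows "bracket x y \<in> S"
proof -
  have "bracket v z \<in> S" if "z \<in> Q" for z
    using subspace_neg[OF S v[OF that]] by (simp add: bracket_antisym[of z v])
  moreover have "bracket v v \<in> S" using subspace_0[OF S] by (simp add: bracket_self)
  ultimately show ?thesis using xy Q v by blast
qed

lemma bracket_derivation: "bracket (bracket x y) z = bracket x (bracket y z) - bracket y (bracket x z)"
proof -
  have "bracket y (bracket z x) = - bracket y (bracket x z)"
    using bracket_antisym[of z x] by (simp only: bracket_right.neg)
  then show ?thesis
    using jacobi[of x y z] bracket_antisym[of "bracket x y" z] by (simp add: algebra_simps)
qed

end

locale lie_module = lie_algebra scale bracket + M: vector_space mscale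
  for scale :: "'k::field \<Rightarrow> 'v::ab_group_add \<Rightarrow> 'v" and bracket
    and mscale :: "'k \<Rightarrow> 'm::ab_group_add \<Rightarrow> 'm" +
  fixes act :: "'v \<Rightarrow> 'm \<Rightarrow> 'm"
  assumes linear_act: "Vector_Spaces.linear mscale mscale (act x)"
    and linear_act_left: "Vector_Spaces.linear scale mscale (\<lambda>x. act x m)"
    and act_bracket: "act (bracket x y) m = act x (act y m) - act y (act x m)"

text \<open>The induced module is realised on words, the sorted word \<open>b\<^sub>1 \<dots> b\<^sub>n\<close> in the complement \<open>B\<close>
  of the subalgebra \<open>span C\<close> standing for \<open>b\<^sub>1 \<cdots> b\<^sub>n w\<close> with the generator \<open>w\<close>.\<close>
locale character_induction = lie_algebra scale bracket
  for scale :: "'k::field \<Rightarrow> 'v::ab_group_add \<Rightarrow> 'v" and bracket +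
  fixes B C :: "'v set" and le :: "'v \<Rightarrow> 'v \<Rightarrow> bool" and \<chi> :: "'v \<Rightarrow> 'k"
  assumes disjoint: "B \<inter> C = {}"
    and independent_basis: "independent (B \<union> C)"
    and span_basis: "span (B \<union> C) = UNIV"
    and le_antisym: "le x y \<Longrightarrow> le y x \<Longrightarrow> x = y"
    and le_trans: "le x y \<Longrightarrow> le y z \<Longrightarrow> le x z"
    and le_total: "le x y \<or> le y x"
    and linear_character: "Vector_Spaces.linear scale (*) \<chi>"
    and bracket_in_span: "x \<in> C \<Longrightarrow> y \<in> C \<Longrightarrow> bracket x y \<in> span C"
    and character_bracket: "x \<in> C \<Longrightarrow> y \<in> C \<Longrightarrow> \<chi> (bracket x y) = 0"
begin

sublocale words: vector_space_pair scale "pm_scale :: 'k \<Rightarrow> ('v list \<Rightarrow>\<^sub>0 'k) \<Rightarrow> 'v list \<Rightarrow>\<^sub>0 'k"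
  by unfold_locales

text \<open>If \<open>x\<close> cannot be prepended to the sorted word \<open>y w\<close>, then
  \<open>x y w = y x w + [x, y] w\<close>. The long words of \<open>x w\<close> consist of \<open>x\<close> and letters of \<open>w\<close>, hence start
  with letters above \<open>y\<close>, and \<open>y\<close> acts on them by prepending; the length test makes the nested
  recursion terminate.\<close>
function basis_act :: "'v \<Rightarrow> 'v list \<Rightarrow> 'v list \<Rightarrow>\<^sub>0 'k" where
  "basis_act x [] = (if x \<in> B then single [x] 1 else single [] (\<chi> x))"
| "basis_act x (y # w) =
    (if x \<in> B \<and> le x y then single (x # y # w) 1
     else lin_ext pm_scale (\<lambda>v. if length v \<le> length w then basis_act y v else single (y # v) 1)
         (basis_act x w)
       + words.construct (B \<union> C) (\<lambda>z. basis_act z w) (bracket x y))"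
  by pat_completeness auto
termination by (relation "measure (\<lambda>(x, w). length w)") auto

definition sorted_words :: "'v list set" where
  "sorted_words = {w. set w \<subseteq> B \<and> sorted_wrt le w}"

definition sorted_word_act :: "'v \<Rightarrow> 'v list \<Rightarrow> 'v list \<Rightarrow>\<^sub>0 'k" where
  "sorted_word_act x w = (if w \<in> sorted_words then words.construct (B \<union> C) (\<lambda>z. basis_act z w) x else 0)"

definition act :: "'v \<Rightarrow> ('v list \<Rightarrow>\<^sub>0 'k) \<Rightarrow> 'v list \<Rightarrow>\<^sub>0 'k" where
  "act x = lin_ext pm_scale (sorted_word_act x)"

lemma linear_act: "Vector_Spaces.linear pm_scale pm_scale (act x)"
  unfolding act_def by (rule pm.linear_lin_ext)

lemma linear_sorted_word_act: "Vector_Spaces.linear scale pm_scale (\<lambda>x. sorted_word_act x w)"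
  using words.linear_construct[OF independent_basis] words.linear_zero
  by (cases "w \<in> sorted_words") (simp_all add: sorted_word_act_def)

lemma linear_act_left: "Vector_Spaces.linear scale pm_scale (\<lambda>x. act x m)"
  unfolding act_def by (intro pm.linear_lin_ext_fun linear_sorted_word_act)

sublocale act: Vector_Spaces.linear pm_scale pm_scale "act x" for x
  by (rule linear_act)

sublocale act_left: Vector_Spaces.linear scale pm_scale "\<lambda>x. act x m" for m
  by (rule linear_act_left)

lemma sorted_word_act_basis: "x \<in> B \<union> C \<Longrightarrow> w \<in> sorted_words \<Longrightarrow> sorted_word_act x w = basis_act x w"
  using words.construct_basis[OF independent_basis] by (simp add: sorted_word_act_def)

lemma act_single: "act x (single w 1) = sorted_word_act x w"
  by (simp add: act_def)

definition reachable :: "'v \<Rightarrow> 'v list \<Rightarrow> 'v list set" where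
  "reachable x w = {v \<in> sorted_words. length v \<le> length w
     \<or> x \<in> B \<and> length v = Suc (length w) \<and> set v \<subseteq> insert x (set w)}"

definition precedes :: "'v \<Rightarrow> 'v list \<Rightarrow> bool" where
  "precedes x w \<longleftrightarrow> x \<in> B \<and> (\<forall>y\<in>set w. le x y)"

lemma precedes_in_B: "precedes x w \<Longrightarrow> x \<in> B"
  by (simp add: precedes_def)

lemma sorted_words_Cons: "y # w \<in> sorted_words \<longleftrightarrow> precedes y w \<and> w \<in> sorted_words"
  by (auto simp: sorted_words_def precedes_def)

lemma precedes_reachable:
  assumes "precedes y w" "\<not> (x \<in> B \<and> le x y)" "v \<in> reachable x w" "\<not> length v \<le> length w"
  shows "precedes y v"
  using assms le_total by (auto simp: precedes_def reachable_def)

lemma Cons_in_reachable: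
  assumes "y # w \<in> sorted_words" "\<not> (x \<in> B \<and> le x y)" "v \<in> reachable x w" "\<not> length v \<le> length w"
  shows "y # v \<in> reachable x (y # w)"
proof -
  have "precedes y v"
    using assms(1) by (intro precedes_reachable[OF _ assms(2-4)]) (simp add: sorted_words_Cons)
  then have "y # v \<in> sorted_words" using assms(3) by (simp add: sorted_words_Cons reachable_def)
  then show ?thesis using assms(3,4) by (auto simp: reachable_def)
qed

lemma keys_construct_subset:
  assumes "\<And>z. z \<in> B \<union> C \<Longrightarrow> keys (f z) \<subseteq> A"
  shows "keys (words.construct (B \<union> C) f x) \<subseteq> A"
proof -
  have "pm.span (f ` (B \<union> C)) \<subseteq> {m. keys m \<subseteq> A}"
    using assms by (intro pm.span_minimal pm_subspace_keys_subset) auto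
  then show ?thesis using words.construct_in_span[OF independent_basis] by blast
qed

lemma keys_basis_act:
  assumes "x \<in> B \<union> C" "w \<in> sorted_words"
  shows "keys (basis_act x w) \<subseteq> reachable x w"
  using assms
proof (induction "length w" arbitrary: x w rule: less_induct)
  case less
  show ?case
  proof (cases w)
    case Nil
    then show ?thesis by (auto simp: reachable_def sorted_words_def)
  next
    case w: (Cons y u)
    have u: "u \<in> sorted_words" and y: "precedes y u"
      using less.prems(2) by (simp_all add: w sorted_words_Cons)
    show ?thesis
    proof (cases "x \<in> B \<and> le x y")
      case True
      then show ?thesis
        using less.prems(2) le_trans by (auto simp: w reachable_def sorted_words_def)
    next
      case False
      have short: "keys (basis_act z v) \<subseteq> reachable x w"
        if "z \<in> B \<union> C" "v \<in> sorted_words" "length v \<le> length u" for z v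
        using less.hyps[of v z] that by (auto simp: w reachable_def)
      have "keys (if length v \<le> length u then basis_act y v else single (y # v) 1) \<subseteq> reachable x w"
        if "v \<in> keys (basis_act x u)" for v
      proof -
        have "v \<in> reachable x u" using that less.hyps[of u x] less.prems(1) u by (auto simp: w)
        then show ?thesis
          using short[of y v] precedes_in_B[OF y] Cons_in_reachable[OF less.prems(2)[unfolded w] False]
          by (auto simp: w reachable_def)
      qed
      moreover have "keys (words.construct (B \<union> C) (\<lambda>z. basis_act z u) (bracket x y)) \<subseteq> reachable x w"
        using short u by (intro keys_construct_subset) auto
      ultimately have "keys (basis_act x (y # u)) \<subseteq> reachable x w \<union> reachable x w"
        unfolding basis_act.simps if_not_P[OF False]
        by (intro order.trans[OF keys_add] Un_mono keys_lin_ext_subset) auto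
      then show ?thesis by (simp add: w)
    qed
  qed
qed

lemma basis_act_precedes: "precedes x w \<Longrightarrow> basis_act x w = single (x # w) 1"
  by (cases w) (auto simp: precedes_def)

lemma act_precedes: "precedes x w \<Longrightarrow> w \<in> sorted_words \<Longrightarrow> act x (single w 1) = single (x # w) 1"
  using precedes_in_B by (simp add: act_single sorted_word_act_basis basis_act_precedes)

definition commutes :: "'v \<Rightarrow> 'v \<Rightarrow> ('v list \<Rightarrow>\<^sub>0 'k) \<Rightarrow> bool" where
  "commutes x y m \<longleftrightarrow> act x (act y m) - act y (act x m) = act (bracket x y) m"

lemma commutes_sym: "commutes y x m \<Longrightarrow> commutes x y m"
  using bracket_antisym[of x y] by (simp add: commutes_def act_left.neg algebra_simps)

lemma commutes_self: "commutes x x m"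
  by (simp add: commutes_def bracket_self act_left.zero)

lemma commutes_if_single:
  assumes "\<And>v. v \<in> keys m \<Longrightarrow> commutes x y (single v 1)"
  shows "commutes x y m"
proof -
  have "pm.subspace {m. commutes x y m}"
    by (rule pm.subspaceI) (simp_all add: commutes_def act.add act.scale
        add_diff_add flip: pm.scale_right_diff_distrib)
  then have "lin_ext pm_scale (\<lambda>v. single v 1) m \<in> {m. commutes x y m}"
    using assms by (intro pm.lin_ext_in_subspace) auto
  then show ?thesis by (simp add: lin_ext_def sum_single_lookup)
qed

lemma commutes_if_basis:
  assumes "\<And>x y. x \<in> B \<union> C \<Longrightarrow> y \<in> B \<union> C \<Longrightarrow> commutes x y m"
  shows "commutes x y m"
proof -
  have subspace: "subspace {x. commutes x y m}" for y
    by (rule subspaceI)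
      (simp_all add: commutes_def bracket_left.add bracket_left.scale act.add act.scale
        act_left.add act_left.scale add_diff_add flip: pm.scale_right_diff_distrib)
  have "span (B \<union> C) \<subseteq> {x. commutes x y m}" if "y \<in> B \<union> C" for y
    using assms that by (intro span_minimal subspace) auto
  then have "commutes x y m" if "y \<in> B \<union> C" for x y
    using that span_basis by (metis UNIV_I mem_Collect_eq subsetD)
  then have "commutes y x m" if "y \<in> B \<union> C" for x y
    using that by (intro commutes_sym[of x y])
  then have "span (B \<union> C) \<subseteq> {y. commutes y x m}" for x
    by (intro span_minimal subspace) auto
  then show ?thesis by (auto simp: span_basis)
qed

lemma commutes_not_precedes:
  assumes x: "x \<in> B \<union> C" "\<not> (x \<in> B \<and> le x y)" and y: "precedes y w" and w: "w \<in> sorted_words"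
  shows "commutes x y (single w 1)"
proof -
  let ?prepend = "\<lambda>v. if length v \<le> length w then basis_act y v else single (y # v) 1"
  have "?prepend v = sorted_word_act y v" if "v \<in> keys (basis_act x w)" for v
  proof -
    have "v \<in> reachable x w" using that keys_basis_act[OF x(1) w] by blast
    moreover have "y \<in> B" using y by (simp add: precedes_def)
    ultimately show ?thesis
      using precedes_reachable[OF y x(2)]
      by (auto simp: sorted_word_act_basis basis_act_precedes reachable_def)
  qed
  then have "lin_ext pm_scale ?prepend (basis_act x w) = act y (basis_act x w)"
    unfolding act_def by (rule lin_ext_cong)
  moreover have "words.construct (B \<union> C) (\<lambda>z. basis_act z w) (bracket x y)
      = act (bracket x y) (single w 1)"
    using w by (simp add: act_single sorted_word_act_def)
  moreover have "act x (act y (single w 1)) = basis_act x (y # w)"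
    unfolding act_precedes[OF y w] unfolding act_single
    using x y w by (simp only: sorted_word_act_basis sorted_words_Cons)
  moreover have "act x (single w 1) = basis_act x w"
    using x w by (simp add: act_single sorted_word_act_basis)
  ultimately show ?thesis using x(2) by (simp add: commutes_def)
qed

lemma commutes_precedes:
  assumes "x \<in> B \<union> C" "y \<in> B \<union> C" "w \<in> sorted_words" "precedes x w \<or> precedes y w"
  shows "commutes x y (single w 1)"
proof -
  have "commutes x y (single w 1)"
    if xy: "x \<in> B \<union> C" "precedes y w" for x y
  proof (cases "x \<in> B \<and> le x y")
    case True
    then have "precedes x w" using xy le_trans by (auto simp: precedes_def)
    moreover have "y \<in> B" using xy by (simp add: precedes_def)
    moreover have "x = y \<or> \<not> le y x" using True le_antisym by blast
    ultimately show ?thesis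
      using assms(3) commutes_self commutes_sym[OF commutes_not_precedes] by blast
  next
    case False
    then show ?thesis using commutes_not_precedes xy assms(3) by blast
  qed
  then show ?thesis using assms commutes_sym by blast
qed

lemma act_Nil_span:
  assumes "x \<in> span C"
  shows "act x (single [] 1) = \<chi> x \<cdot> single [] 1"
proof (rule words.linear_eq_on[OF linear_act_left _ assms])
  interpret \<chi>: Vector_Spaces.linear scale "(*)" \<chi> by (rule linear_character)
  show "Vector_Spaces.linear scale pm_scale (\<lambda>x. \<chi> x \<cdot> single [] 1)"
    by unfold_locales (simp_all add: \<chi>.add \<chi>.scale pm.scale_left_distrib flip: single_add distrib_right)
  show "act b (single [] 1) = \<chi> b \<cdot> single [] 1" if "b \<in> C" for b
    using that disjoint by (auto simp: act_single sorted_word_act_basis sorted_words_def)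
qed

lemma commutes_Nil: "x \<in> C \<Longrightarrow> y \<in> C \<Longrightarrow> commutes x y (single [] 1)"
  by (simp add: commutes_def act_Nil_span[OF bracket_in_span] act_Nil_span[OF span_base] act.scale
      character_bracket mult.commute del: pm_scale_single)

lemma commutes_act:
  assumes "commutes x t (act y m)" "commutes y t (act x m)" and m: "\<And>a b. commutes a b m"
  shows "commutes x y (act t m)"
proof -
  have swap: "act a (act b m) = act b (act a m) + act (bracket a b) m" for a b
    using m[of a b] by (simp add: commutes_def algebra_simps)
  have "act x (act y (act t m)) = act x (act t (act y m)) + act x (act (bracket y t) m)"
    by (simp add: swap[of y t] act.add)
  also have "\<dots> = act t (act x (act y m)) + act (bracket x t) (act y m)
      + act (bracket y t) (act x m) + act (bracket x (bracket y t)) m"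
    using assms(1) swap[of x "bracket y t"] by (simp add: commutes_def algebra_simps)
  finally have xyt: "act x (act y (act t m)) = \<dots>" .
  have "act y (act x (act t m)) = act y (act t (act x m)) + act y (act (bracket x t) m)"
    by (simp add: swap[of x t] act.add)
  also have "\<dots> = act t (act y (act x m)) + act (bracket y t) (act x m)
      + act (bracket x t) (act y m) + act (bracket y (bracket x t)) m"
    using assms(2) swap[of y "bracket x t"] by (simp add: commutes_def algebra_simps)
  finally have "act x (act y (act t m)) - act y (act x (act t m))
      = act t (act x (act y m) - act y (act x m))
        + (act (bracket x (bracket y t)) m - act (bracket y (bracket x t)) m)"
    using xyt by (simp add: act.diff)
  also have "\<dots> = act t (act (bracket x y) m) + act (bracket (bracket x y) t) m"
    using m[of x y] by (simp add: commutes_def bracket_derivation act_left.diff)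
  also have "\<dots> = act (bracket x y) (act t m)"
    by (simp add: swap[of "bracket x y" t])
  finally show ?thesis by (simp add: commutes_def)
qed

lemma commutes_first_letter:
  assumes word: "t # u \<in> sorted_words"
    and IH: "\<And>v a b. v \<in> sorted_words \<Longrightarrow> length v \<le> length u \<Longrightarrow> commutes a b (single v 1)"
    and ab: "a \<in> B \<union> C" "b \<in> B \<union> C" "\<not> (b \<in> B \<and> le b t)"
  shows "commutes a t (act b (single u 1))"
proof (rule commutes_if_single)
  have t: "precedes t u" and u: "u \<in> sorted_words" using word by (simp_all add: sorted_words_Cons)
  fix v assume "v \<in> keys (act b (single u 1))"
  then have v: "v \<in> reachable b u"
    using keys_basis_act[OF ab(2) u] ab u by (auto simp: act_single sorted_word_act_basis)
  show "commutes a t (single v 1)"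
  proof (cases "length v \<le> length u")
    case True
    then show ?thesis using IH v by (simp add: reachable_def)
  next
    case False
    then have "precedes t v" using precedes_reachable[OF t ab(3) v] by blast
    then show ?thesis
      using commutes_precedes ab precedes_in_B[OF t] v by (auto simp: reachable_def)
  qed
qed

lemma commutes_sorted_word: "w \<in> sorted_words \<Longrightarrow> commutes x y (single w 1)"
proof (induction "length w" arbitrary: x y w rule: less_induct)
  case less
  show ?case
  proof (rule commutes_if_basis)
    fix x y assume xy: "x \<in> B \<union> C" "y \<in> B \<union> C"
    consider (minimal) "precedes x w \<or> precedes y w" | (empty) "w = []" "x \<in> C" "y \<in> C"
      | (above) t u where "w = t # u" "\<not> precedes x w" "\<not> precedes y w"
      using xy by (cases w) (auto simp: precedes_def)
    then show "commutes x y (single w 1)"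
    proof cases
      case minimal
      then show ?thesis using commutes_precedes xy less.prems by blast
    next
      case empty
      then show ?thesis by (simp add: commutes_Nil)
    next
      case above
      then have t: "precedes t u" and u: "u \<in> sorted_words" and word: "t # u \<in> sorted_words"
        using less.prems by (simp_all add: sorted_words_Cons)
      have not_le: "\<not> (x \<in> B \<and> le x t)" "\<not> (y \<in> B \<and> le y t)"
        using above t le_trans by (auto simp: precedes_def)
      have IH: "commutes a b (single v 1)" if "v \<in> sorted_words" "length v \<le> length u" for v a b
        using less.hyps[of v] that above(1) by simp
      have "commutes x t (act y (single u 1))" "commutes y t (act x (single u 1))"
        using commutes_first_letter[OF word IH] xy not_le by blast+
      moreover have "commutes a b (single u 1)" for a b using IH u by simp
      ultimately have "commutes x y (act t (single u 1))" by (rule commutes_act)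
      then show ?thesis using t u above(1) by (simp add: act_precedes)
    qed
  qed
qed

lemma lie_module_act: "lie_module scale bracket pm_scale act"
proof unfold_locales
  fix x y and m :: "'v list \<Rightarrow>\<^sub>0 'k"
  have "commutes x y (single w 1)" for w
  proof (cases "w \<in> sorted_words")
    case False
    then have "act z (single w 1) = 0" for z by (simp add: act_single sorted_word_act_def)
    then show ?thesis by (simp add: commutes_def)
  qed (rule commutes_sorted_word)
  then show "act (bracket x y) m = act x (act y m) - act y (act x m)"
    using commutes_if_single[of m x y] by (simp add: commutes_def)
qed

end

theorem (in lie_algebra) ex_module_with_character:
  assumes \<chi>: "Vector_Spaces.linear scale (*) \<chi>"
    and closed: "\<And>x y. x \<in> Q \<Longrightarrow> y \<in> Q \<Longrightarrow> bracket x y \<in> span Q \<and> \<chi> (bracket x y) = 0"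
  shows "\<exists>act (w :: 'v list \<Rightarrow>\<^sub>0 'k). lie_module scale bracket pm_scale act \<and> w \<noteq> 0 \<and>
    (\<forall>q\<in>Q. act q w = \<chi> q \<cdot> w)"
proof -
  obtain C where C: "C \<subseteq> Q" "independent C" "Q \<subseteq> span C"
    using maximal_independent_subset[of Q] by blast
  obtain D where D: "C \<subseteq> D" "D \<subseteq> UNIV" "independent D" "UNIV \<subseteq> span D"
    by (rule maximal_independent_subset_extend[OF subset_UNIV C(2)])
  obtain r :: "'v rel" where "well_order_on UNIV r" using well_order_on[of UNIV] by blast
  then have r: "antisym r" "trans r" "refl r" "total r"
    by (simp_all add: well_order_on_def linear_order_on_def partial_order_on_def preorder_on_def)
  have span_C: "span C = span Q" using C by (metis span_eq span_superset subset_trans)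
  interpret \<chi>: Vector_Spaces.linear scale "(*)" \<chi> by (rule \<chi>)
  interpret character_induction scale bracket "D - C" C "\<lambda>x y. (x, y) \<in> r" \<chi>
  proof unfold_locales
    show "independent (D - C \<union> C)" "span (D - C \<union> C) = UNIV" using D by (auto simp: Un_absorb2)
    show "x = y" if "(x, y) \<in> r" "(y, x) \<in> r" for x y using r(1) that by (rule antisymD)
    show "(x, z) \<in> r" if "(x, y) \<in> r" "(y, z) \<in> r" for x y z using r(2) that by (rule transD)
    show "(x, y) \<in> r \<or> (y, x) \<in> r" for x y
      using r(3,4) by (cases "x = y") (auto simp: total_on_def refl_on_def)
    show "bracket x y \<in> span C" "\<chi> (bracket x y) = 0" if "x \<in> C" "y \<in> C" for x y
      using closed that C(1) by (auto simp: span_C)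
  qed auto
  have "act q (single [] 1) = \<chi> q \<cdot> single [] 1" if "q \<in> Q" for q
    using act_Nil_span that C(3) by blast
  moreover have "single [] (1 :: 'k) \<noteq> 0"
    by (metis keys_single keys_zero insert_not_empty one_neq_zero)
  ultimately show ?thesis using lie_module_act
    by (intro exI[of _ act] exI[of _ "single [] 1"]) blast
qed

section \<open>Lie algebras given by structure constants\<close>

definition bilinear_ext :: "('i \<Rightarrow> 'i \<Rightarrow> 'i \<Rightarrow>\<^sub>0 'a::field) \<Rightarrow> ('i \<Rightarrow>\<^sub>0 'a) \<Rightarrow> ('i \<Rightarrow>\<^sub>0 'a) \<Rightarrow> 'i \<Rightarrow>\<^sub>0 'a" where
  "bilinear_ext c x y = lin_ext pm_scale (\<lambda>i. lin_ext pm_scale (c i) y) x"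

lemma linear_bilinear_ext_right: "Vector_Spaces.linear pm_scale pm_scale (bilinear_ext c x)"
  unfolding bilinear_ext_def by (intro pm.linear_lin_ext_fun pm.linear_lin_ext)

lemma linear_bilinear_ext_left: "Vector_Spaces.linear pm_scale pm_scale (\<lambda>x. bilinear_ext c x y)"
  unfolding bilinear_ext_def by (rule pm.linear_lin_ext)

lemma bilinear_ext_single_left: "bilinear_ext c (single i 1) y = lin_ext pm_scale (c i) y"
  by (simp add: bilinear_ext_def)

lemma bilinear_ext_antisym:
  fixes c :: "'i \<Rightarrow> 'i \<Rightarrow> 'i \<Rightarrow>\<^sub>0 'a::field"
  assumes "\<And>i j. c j i = - c i j"
  shows "bilinear_ext c x y = - bilinear_ext c y x"
proof -
  interpret vector_space_pair pm_scale "pm_scale :: 'a \<Rightarrow> ('i \<Rightarrow>\<^sub>0 'a) \<Rightarrow> _" ..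
  note left = linear_bilinear_ext_left and right = linear_bilinear_ext_right
  have "bilinear_ext c (single i 1) y = - bilinear_ext c y (single i 1)" for i y
    by (rule linear_eq_on_single[OF right linear_compose_neg[OF left]])
      (simp add: bilinear_ext_def flip: assms)
  then show ?thesis
    by (rule linear_eq_on_single[OF left linear_compose_neg[OF right]])
qed

definition jacobiator :: "('i \<Rightarrow> 'i \<Rightarrow> 'i \<Rightarrow>\<^sub>0 'a::field) \<Rightarrow> 'i \<Rightarrow> 'i \<Rightarrow> 'i \<Rightarrow> 'i \<Rightarrow>\<^sub>0 'a" where
  "jacobiator c i j k = lin_ext pm_scale (c i) (c j k) + lin_ext pm_scale (c j) (c k i)
    + lin_ext pm_scale (c k) (c i j)"

lemma jacobiator_rotate: "jacobiator c j k i = jacobiator c i j k"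
  by (simp add: jacobiator_def add_ac)

lemma bilinear_ext_jacobi:
  fixes c :: "'i \<Rightarrow> 'i \<Rightarrow> 'i \<Rightarrow>\<^sub>0 'a::field"
  assumes "\<And>i j k. jacobiator c i j k = 0"
  shows "bilinear_ext c x (bilinear_ext c y z) + bilinear_ext c y (bilinear_ext c z x)
    + bilinear_ext c z (bilinear_ext c x y) = 0"
proof -
  let ?b = "bilinear_ext c"
  interpret right: Vector_Spaces.linear pm_scale pm_scale "?b x" for x
    by (rule linear_bilinear_ext_right)
  interpret left: Vector_Spaces.linear pm_scale pm_scale "\<lambda>x. ?b x y" for y
    by (rule linear_bilinear_ext_left)
  interpret vector_space_pair pm_scale "pm_scale :: 'a \<Rightarrow> ('i \<Rightarrow>\<^sub>0 'a) \<Rightarrow> _" ..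
  define J where "J x y z = ?b x (?b y z) + ?b y (?b z x) + ?b z (?b x y)" for x y z
  have rotate: "J x y z = J y z x" for x y z by (simp add: J_def)
  have linear: "Vector_Spaces.linear pm_scale pm_scale (\<lambda>x. J x y z)" for y z
    by unfold_locales
      (simp_all add: J_def left.add left.scale right.add right.scale pm.scale_right_distrib)
  have basis: "J x y z = 0" if "\<And>i. J (single i 1) y z = 0" for x y z
    by (rule linear_eq_on_single[OF linear linear_zero that])
  have "J (single i 1) (single j 1) (single k 1) = 0" for i j k
    using assms[of i j k] by (simp add: J_def jacobiator_def bilinear_ext_single_left)
  then have "J x (single j 1) (single k 1) = 0" for x j k by (rule basis)
  then have "J x y (single k 1) = 0" for x y k by (metis basis rotate)
  then have "J x y z = 0" for x y z by (metis basis rotate)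
  then show ?thesis by (simp add: J_def)
qed

lemma lie_algebra_structure_constants:
  fixes c :: "'i \<Rightarrow> 'i \<Rightarrow> 'i \<Rightarrow>\<^sub>0 'a::field_char_0"
  assumes antisym: "\<And>i j. c j i = - c i j" and jacobi: "\<And>i j k. jacobiator c i j k = 0"
  shows "lie_algebra pm_scale (bilinear_ext c)"
proof (intro lie_algebra.intro lie_algebra_axioms.intro pm.vector_space_axioms
    linear_bilinear_ext_left linear_bilinear_ext_right bilinear_ext_jacobi jacobi)
  show "bilinear_ext c x x = 0" for x
  proof (rule poly_mapping_eqI)
    show "lookup (bilinear_ext c x x) i = lookup 0 i" for i
      using arg_cong[OF bilinear_ext_antisym[OF antisym, where x = x and y = x], of "\<lambda>y. lookup y i"]
      by simp
  qed
qed

section \<open>The mirror Heisenberg-Virasoro algebra\<close>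

abbreviation basis_vec :: "gen \<Rightarrow> gen \<Rightarrow>\<^sub>0 complex" where
  "basis_vec x \<equiv> single x 1"

definition structure_const :: "gen \<Rightarrow> gen \<Rightarrow> gen \<Rightarrow>\<^sub>0 complex" where
  "structure_const x y = Poly_Mapping.map_key (\<lambda>z. [z]) (br x y)"

lemma structure_const_simps:
  "structure_const (D m) (D n) = of_int (m - n) \<cdot> basis_vec (D (m + n))
    + (if m + n = 0 then of_int (m ^ 3 - m) / 12 else 0) \<cdot> basis_vec C"
  "structure_const (D m) (H n) = (- (of_int n + 1/2)) \<cdot> basis_vec (H (m + n))"
  "structure_const (H n) (D m) = (of_int n + 1/2) \<cdot> basis_vec (H (m + n))"
  "structure_const (H n) (H k) = (if n + k = -1 then of_int n + 1/2 else 0) \<cdot> basis_vec L"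
  "structure_const C x = 0" "structure_const x C = 0"
  "structure_const L x = 0" "structure_const x L = 0"
proof -
  have inj: "inj (\<lambda>z :: gen. [z])" by (simp add: inj_def)
  note map_key = map_key_plus[OF inj] map_key_single[OF inj] map_key_zero[OF inj]
  show "structure_const (D m) (D n) = of_int (m - n) \<cdot> basis_vec (D (m + n))
    + (if m + n = 0 then of_int (m ^ 3 - m) / 12 else 0) \<cdot> basis_vec C"
    "structure_const (D m) (H n) = (- (of_int n + 1/2)) \<cdot> basis_vec (H (m + n))"
    "structure_const (H n) (D m) = (of_int n + 1/2) \<cdot> basis_vec (H (m + n))"
    "structure_const (H n) (H k) = (if n + k = -1 then of_int n + 1/2 else 0) \<cdot> basis_vec L"
    by (simp_all add: structure_const_def map_key del: of_int_diff of_int_power)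
  show "structure_const C x = 0" "structure_const x C = 0"
    "structure_const L x = 0" "structure_const x L = 0"
    by (cases x; simp add: structure_const_def map_key)+
qed

lemma structure_const_antisym: "structure_const y x = - structure_const x y"
proof -
  have DD: "structure_const (D n) (D m) = - structure_const (D m) (D n)" for m n
  proof (cases "m + n = 0")
    case True
    then have "n = - m" by simp
    then show ?thesis by (simp add: structure_const_simps minus_divide_left flip: single_uminus)
  next
    case False
    then show ?thesis by (simp add: structure_const_simps add.commute flip: single_uminus)
  qed
  have HH: "structure_const (H n) (H m) = - structure_const (H m) (H n)" for m n
  proof (cases "m + n = -1")
    case True
    then have "n = - 1 - m" by simp
    then show ?thesis
      by (simp add: structure_const_simps flip: single_uminus) (rule arg_cong[of _ _ "single L"], simp)
  next
    case False
    then show ?thesis by (simp add: structure_const_simps add.commute)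
  qed
  show ?thesis
    by (cases x; cases y; simp only:;
        (rule DD HH | simp add: structure_const_simps add.commute flip: single_uminus))
qed

lemmas jacobiator_structure_const_simps =
  jacobiator_def structure_const_simps pm.lin_ext_add pm.lin_ext_scale lookup_add

lemma jacobiator_D_D_D: "jacobiator structure_const (D i) (D j) (D k) = 0"
proof (rule poly_mapping_eqI)
  fix g
  show "lookup (jacobiator structure_const (D i) (D j) (D k)) g = lookup 0 g"
  proof (cases "i + j + k = 0")
    case True
    then have "k = - i - j" by simp
    then show ?thesis
      by (simp add: jacobiator_structure_const_simps del: pm_scale_single split del: if_split)
        (simp add: field_simps power3_eq_cube)
  next
    case False
    moreover have "D (j + (k + i)) = D (i + (j + k))" "D (k + (i + j)) = D (i + (j + k))" by auto
    ultimately show ?thesis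
      by (simp add: jacobiator_structure_const_simps add.assoc del: pm_scale_single)
        (simp add: field_simps)
  qed
qed

lemma jacobiator_D_D_H: "jacobiator structure_const (D i) (D j) (H k) = 0"
proof (rule poly_mapping_eqI)
  fix g
  have "H (j + (i + k)) = H (i + (j + k))" "H (i + j + k) = H (i + (j + k))" by auto
  then show "lookup (jacobiator structure_const (D i) (D j) (H k)) g = lookup 0 g"
    by (simp add: jacobiator_structure_const_simps del: pm_scale_single) (simp add: field_simps)
qed

lemma jacobiator_D_H_H: "jacobiator structure_const (D i) (H j) (H k) = 0"
proof (rule poly_mapping_eqI)
  fix g
  show "lookup (jacobiator structure_const (D i) (H j) (H k)) g = lookup 0 g"
  proof (cases "i + j + k = -1")
    case True
    then have "k = - 1 - i - j" by simp
    then show ?thesis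
      by (simp add: jacobiator_structure_const_simps del: pm_scale_single) (simp add: field_simps)
  next
    case False
    then show ?thesis by (simp add: jacobiator_structure_const_simps add_ac del: pm_scale_single)
  qed
qed

lemma jacobiator_structure_const: "jacobiator structure_const x y z = 0"
proof -
  note rotate = jacobiator_rotate[THEN trans]
  note rotations = jacobiator_D_D_D
    jacobiator_D_D_H rotate[OF jacobiator_D_D_H] rotate[OF rotate[OF jacobiator_D_D_H]]
    jacobiator_D_H_H rotate[OF jacobiator_D_H_H] rotate[OF rotate[OF jacobiator_D_H_H]]
  show ?thesis
    by (cases x; cases y; cases z)
      (simp_all add: rotations, simp_all add: jacobiator_structure_const_simps)
qed

definition bracket :: "(gen \<Rightarrow>\<^sub>0 complex) \<Rightarrow> (gen \<Rightarrow>\<^sub>0 complex) \<Rightarrow> gen \<Rightarrow>\<^sub>0 complex" where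
  "bracket = bilinear_ext structure_const"

interpretation hv: lie_algebra pm_scale bracket
  unfolding bracket_def
  by (intro lie_algebra_structure_constants structure_const_antisym jacobiator_structure_const)

lemma bracket_basis_vec: "bracket (basis_vec x) (basis_vec y) = structure_const x y"
  by (simp add: bracket_def bilinear_ext_single_left)

section \<open>The tensor algebra and its left ideals\<close>

text \<open>Words form a monoid under concatenation, so that \<open>tmul\<close> is the convolution product of
  \<open>Poly_Mapping\<close>.\<close>
instantiation list :: (type) monoid_add
begin

definition plus_list :: "'a list \<Rightarrow> 'a list \<Rightarrow> 'a list" where
  "plus_list u v = u @ v"

definition zero_list :: "'a list" where
  "zero_list = []"

instance by standard (simp_all add: plus_list_def zero_list_def)

end

lemma pm_scale_mult_left:
  fixes x y :: "'i::monoid_add \<Rightarrow>\<^sub>0 'a::field"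
  shows "(c \<cdot> x) * y = c \<cdot> (x * y)"
  by (simp add: pm_scale_def mult_map_scale_conv_mult mult.assoc)

lemma pm_scale_mult_right:
  fixes x y :: "'i::monoid_add \<Rightarrow>\<^sub>0 'a::field"
  shows "x * (c \<cdot> y) = c \<cdot> (x * y)"
proof -
  have "Vector_Spaces.linear pm_scale pm_scale (\<lambda>x :: 'i \<Rightarrow>\<^sub>0 'a. x * single 0 c)"
    by unfold_locales (simp_all add: distrib_right pm_scale_mult_left)
  then have "x * single 0 c = c \<cdot> x"
    by (rule linear_eq_on_single[OF _ pm.linear_scale_self]) (simp add: mult_single)
  moreover have "c \<cdot> y = single 0 c * y"
    by (simp add: pm_scale_def mult_map_scale_conv_mult)
  ultimately have "x * (c \<cdot> y) = (c \<cdot> x) * y" by (metis mult.assoc)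
  then show ?thesis by (simp only: pm_scale_mult_left)
qed

lemma linear_times_left:
  "Vector_Spaces.linear pm_scale pm_scale (\<lambda>x :: 'i::monoid_add \<Rightarrow>\<^sub>0 'a::field. x * y)"
  by unfold_locales (simp_all add: distrib_right pm_scale_mult_left)

lemma linear_times_right:
  "Vector_Spaces.linear pm_scale pm_scale (\<lambda>y :: 'i::monoid_add \<Rightarrow>\<^sub>0 'a::field. x * y)"
  by unfold_locales (simp_all add: distrib_left pm_scale_mult_right)

lemma single_mult_single_word: "single u a * single v b = single (u @ v) (a * b)"
  by (simp add: mult_single plus_list_def)

lemma one_eq_single_Nil: "(1 :: 'a list \<Rightarrow>\<^sub>0 'b::zero_neq_one) = single [] 1"
  by (simp add: zero_list_def flip: single_one)

lemma tmul_eq_times: "tmul a b = a * b"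
proof -
  have "a * b = (\<Sum>u\<in>keys a. single u (lookup a u)) * (\<Sum>v\<in>keys b. single v (lookup b v))"
    by (simp add: sum_single_lookup)
  then show ?thesis by (simp add: tmul_def sum_product single_mult_single_word)
qed

lemma tscal_eq_scale_one: "tscal c = c \<cdot> 1"
  by (simp add: tscal_def one_eq_single_Nil)

lemma left_ideal_iff: "left_ideal S \<longleftrightarrow> pm.subspace S \<and> (\<forall>a. \<forall>x\<in>S. a * x \<in> S)"
proof -
  have "c \<cdot> x = tscal c * x" for c x by (simp add: tscal_eq_scale_one pm_scale_mult_left)
  then show ?thesis by (auto simp: left_ideal_def pm.subspace_def tmul_eq_times)
qed

lemma left_ideal_imp_subspace: "left_ideal S \<Longrightarrow> pm.subspace S"
  by (simp add: left_ideal_iff)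

lemma left_ideal_mult: "left_ideal S \<Longrightarrow> x \<in> S \<Longrightarrow> a * x \<in> S"
  by (simp add: left_ideal_iff)

lemma left_ideal_eq_UNIV: "left_ideal S \<Longrightarrow> 1 \<in> S \<Longrightarrow> S = UNIV"
  using left_ideal_mult[of S 1] by auto

lemma left_ideal_Wker: "left_ideal (Wker \<phi>)"
  unfolding Wker_def left_ideal_def by auto

lemma Wker_least: "left_ideal S \<Longrightarrow> Wgens \<phi> \<subseteq> S \<Longrightarrow> Wker \<phi> \<subseteq> S"
  unfolding Wker_def by blast

lemma Wgens_subset_Wker: "Wgens \<phi> \<subseteq> Wker \<phi>"
  unfolding Wker_def by auto

definition commutator_relation :: "gen \<Rightarrow> gen \<Rightarrow> tens" where
  "commutator_relation x y = gvec x * gvec y - gvec y * gvec x - br x y"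

lemma Wgens_eq:
  "Wgens \<phi> = {a * commutator_relation x y * b | a b x y. True} \<union> {gvec p - \<phi> p \<cdot> 1 | p. in_p p}"
  by (simp add: Wgens_def commutator_relation_def tmul_eq_times tscal_eq_scale_one)

definition linear_tens :: "(gen \<Rightarrow>\<^sub>0 complex) \<Rightarrow> tens" where
  "linear_tens = lin_ext pm_scale gvec"

lemma linear_linear_tens: "Vector_Spaces.linear pm_scale pm_scale linear_tens"
  unfolding linear_tens_def by (rule pm.linear_lin_ext)

lemma br_eq_linear_tens: "br x y = linear_tens (structure_const x y)"
  by (cases x; cases y)
    (simp_all add: structure_const_simps linear_tens_def gvec_def pm.lin_ext_add pm.lin_ext_scale
      del: of_int_diff of_int_power)

section \<open>Proper left ideals from characters\<close>

context lie_module
begin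

definition word_act :: "('i \<Rightarrow> 'v) \<Rightarrow> 'i list \<Rightarrow> 'm \<Rightarrow> 'm" where
  "word_act e w m = foldr (\<lambda>i. act (e i)) w m"

lemma linear_word_act: "Vector_Spaces.linear mscale mscale (word_act e w)"
proof (induction w)
  case Nil
  then show ?case by (simp add: word_act_def M.linear_ident)
next
  case (Cons i w)
  have "word_act e (i # w) = act (e i) \<circ> word_act e w" by (simp add: word_act_def fun_eq_iff)
  then show ?case by (simp only: Vector_Spaces.linear_compose[OF Cons linear_act])
qed

definition tensor_act :: "('i \<Rightarrow> 'v) \<Rightarrow> ('i list \<Rightarrow>\<^sub>0 'k) \<Rightarrow> 'm \<Rightarrow> 'm" where
  "tensor_act e u m = lin_ext mscale (\<lambda>w. word_act e w m) u"

sublocale tensor_act_left: Vector_Spaces.linear pm_scale mscale "\<lambda>u. tensor_act e u m" for e m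
  unfolding tensor_act_def by (rule M.linear_lin_ext)

sublocale tensor_act: Vector_Spaces.linear mscale mscale "tensor_act e u" for e u
  unfolding tensor_act_def by (intro M.linear_lin_ext_fun linear_word_act)

lemma tensor_act_single: "tensor_act e (single w 1) m = word_act e w m"
  by (simp add: tensor_act_def)

lemma tensor_act_one: "tensor_act e 1 m = m"
  by (simp add: one_eq_single_Nil tensor_act_single word_act_def)

lemma tensor_act_mult: "tensor_act e (u * v) m = tensor_act e u (tensor_act e v m)"
proof -
  note compose = Vector_Spaces.linear_compose[unfolded comp_def]
  interpret vector_space_pair pm_scale mscale ..
  have "tensor_act e (single w 1 * v) m = tensor_act e (single w 1) (tensor_act e v m)" for w v
  proof (rule linear_eq_on_single)
    show "Vector_Spaces.linear pm_scale mscale (\<lambda>v. tensor_act e (single w 1 * v) m)"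
      by (rule compose[OF linear_times_right tensor_act_left.linear_axioms])
    show "Vector_Spaces.linear pm_scale mscale (\<lambda>v. tensor_act e (single w 1) (tensor_act e v m))"
      by (rule compose[OF tensor_act_left.linear_axioms tensor_act.linear_axioms])
    show "tensor_act e (single w 1 * single w' 1) m
        = tensor_act e (single w 1) (tensor_act e (single w' 1) m)" for w'
      by (simp add: single_mult_single_word tensor_act_single word_act_def)
  qed
  then show ?thesis
    by (rule linear_eq_on_single[OF compose[OF linear_times_left tensor_act_left.linear_axioms]
          tensor_act_left.linear_axioms])
qed

end

lemma ex_proper_left_ideal_of_character:
  assumes \<chi>: "Vector_Spaces.linear pm_scale (*) \<chi>"
    and closed: "\<And>x y. x \<in> Q \<Longrightarrow> y \<in> Q \<Longrightarrow> bracket x y \<in> pm.span Q \<and> \<chi> (bracket x y) = 0"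
    and extends: "\<And>p. in_p p \<Longrightarrow> basis_vec p \<in> Q \<and> \<chi> (basis_vec p) = \<phi> p"
  shows "\<exists>S. left_ideal S \<and> Wker \<phi> \<subseteq> S \<and> 1 \<notin> S \<and> (\<forall>q\<in>Q. linear_tens q - \<chi> q \<cdot> 1 \<in> S)"
proof -
  obtain act and w :: "(gen \<Rightarrow>\<^sub>0 complex) list \<Rightarrow>\<^sub>0 complex"
    where act: "lie_module pm_scale bracket pm_scale act" and "w \<noteq> 0"
      and w: "\<And>q. q \<in> Q \<Longrightarrow> act q w = \<chi> q \<cdot> w"
    using hv.ex_module_with_character[OF \<chi> closed] by blast
  interpret lie_module pm_scale bracket pm_scale act by (rule act)
  define S where "S = {u. tensor_act (\<lambda>x. basis_vec x) u w = 0}"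
  have ideal: "left_ideal S"
    unfolding left_ideal_iff S_def
    by (auto simp: tensor_act_left.subspace_kernel tensor_act_mult tensor_act.zero)
  have tensor_act_gvec: "tensor_act (\<lambda>x. basis_vec x) (gvec x) m = act (basis_vec x) m" for x m
    by (simp add: gvec_def tensor_act_single word_act_def)
  have tensor_act_linear_tens: "tensor_act (\<lambda>x. basis_vec x) (linear_tens v) m = act v m" for v m
    by (rule linear_eq_on_single[OF Vector_Spaces.linear_compose[unfolded comp_def,
            OF linear_linear_tens tensor_act_left.linear_axioms] linear_act_left])
      (simp add: linear_tens_def tensor_act_gvec)
  have "tensor_act (\<lambda>x. basis_vec x) (commutator_relation x y) m = 0" for x y m
    unfolding commutator_relation_def tensor_act_left.diff tensor_act_mult tensor_act_gvec
      br_eq_linear_tens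
    by (simp add: tensor_act_linear_tens act_bracket flip: bracket_basis_vec)
  then have "a * commutator_relation x y * b \<in> S" for a x y b
    by (simp add: S_def tensor_act_mult tensor_act.zero)
  moreover have character: "linear_tens q - \<chi> q \<cdot> 1 \<in> S" if "q \<in> Q" for q
    by (simp add: S_def tensor_act_left.diff tensor_act_left.scale tensor_act_linear_tens
        tensor_act_one w that)
  moreover have "gvec p - \<phi> p \<cdot> 1 \<in> S" if "in_p p" for p
    using character[of "basis_vec p"] extends[OF that] by (simp add: linear_tens_def)
  ultimately have "Wker \<phi> \<subseteq> S" by (intro Wker_least[OF ideal]) (auto simp: Wgens_eq)
  moreover have "1 \<notin> S" using \<open>w \<noteq> 0\<close> by (simp add: S_def tensor_act_one)
  ultimately show ?thesis using ideal character by blast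
qed

abbreviation \<pp>_basis :: "(gen \<Rightarrow>\<^sub>0 complex) set" where
  "\<pp>_basis \<equiv> {basis_vec x | x. in_p x}"

lemma bracket_p_p:
  assumes "in_p x" "in_p y" and \<chi>: "Vector_Spaces.linear pm_scale (*) \<chi>" "\<chi> (basis_vec L) = 0"
  shows "bracket (basis_vec x) (basis_vec y) \<in> pm.span \<pp>_basis \<and>
    \<chi> (bracket (basis_vec x) (basis_vec y)) = 0"
proof -
  interpret \<chi>: Vector_Spaces.linear pm_scale "(*)" \<chi> by (rule \<chi>)
  obtain c where "bracket (basis_vec x) (basis_vec y) = c \<cdot> basis_vec L"
  proof -
    have "\<exists>c. structure_const x y = c \<cdot> basis_vec L"
      using assms(1,2)
      by (cases x; cases y) (auto simp: in_p_def structure_const_simps intro: exI[of _ 0])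
    then show ?thesis using that by (auto simp: bracket_basis_vec)
  qed
  moreover have "basis_vec L \<in> pm.span \<pp>_basis" by (intro pm.span_base) (auto simp: in_p_def)
  ultimately show ?thesis using \<chi>(2) by (simp add: pm.span_scale \<chi>.scale del: pm_scale_single)
qed

lemma Wker_neq_UNIV:
  assumes "\<phi> L = 0"
  shows "Wker \<phi> \<noteq> UNIV"
proof -
  interpret fld: vector_space "(*) :: complex \<Rightarrow> _" by (rule vector_space_field)
  have \<chi>: "Vector_Spaces.linear pm_scale (*) (lin_ext (*) \<phi>)" by (rule fld.linear_lin_ext)
  have "bracket u v \<in> pm.span \<pp>_basis \<and> lin_ext (*) \<phi> (bracket u v) = 0"
    if "u \<in> \<pp>_basis" "v \<in> \<pp>_basis" for u v
    using that bracket_p_p[OF _ _ \<chi>] assms by auto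
  then have "\<exists>S. left_ideal S \<and> Wker \<phi> \<subseteq> S \<and> 1 \<notin> S \<and>
      (\<forall>q\<in>\<pp>_basis. linear_tens q - lin_ext (*) \<phi> q \<cdot> 1 \<in> S)"
    by (rule ex_proper_left_ideal_of_character[OF \<chi>]) auto
  then show ?thesis by blast
qed

section \<open>Reducibility for recurrent characters\<close>

definition annihilating_vec :: "complex poly \<Rightarrow> gen \<Rightarrow>\<^sub>0 complex" where
  "annihilating_vec p = (\<Sum>i\<le>degree p. coeff p i \<cdot> basis_vec (D (int i)))"

lemma bracket_H_annihilating_vec:
  "bracket (basis_vec (H n)) (annihilating_vec p)
    = (of_int n + 1/2) \<cdot> (\<Sum>i\<le>degree p. coeff p i \<cdot> basis_vec (H (n + int i)))"
proof -
  have "bracket (basis_vec (H n)) (coeff p i \<cdot> basis_vec (D (int i)))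
      = (of_int n + 1/2) \<cdot> coeff p i \<cdot> basis_vec (H (n + int i))" for i
    by (simp only: hv.bracket_right.scale bracket_basis_vec structure_const_simps
        add.commute pm.scale_left_commute)
  then show ?thesis
    by (simp only: annihilating_vec_def hv.bracket_right.sum pm.scale_sum_right)
qed

lemma bracket_p_annihilating_vec:
  assumes x: "in_p x" and \<chi>: "Vector_Spaces.linear pm_scale (*) \<chi>"
    and extends: "\<And>n. \<chi> (basis_vec (H n)) = \<phi> (H n)"
    and recurrence: "shift_op p (\<lambda>n. \<phi> (H n)) = 0"
  shows "bracket (basis_vec x) (annihilating_vec p) \<in> pm.span \<pp>_basis \<and>
    \<chi> (bracket (basis_vec x) (annihilating_vec p)) = 0"
proof (cases "\<exists>n. x = H n")
  case True
  then obtain n where n: "x = H n" by blast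
  interpret \<chi>: Vector_Spaces.linear pm_scale "(*)" \<chi> by (rule \<chi>)
  have "basis_vec (H k) \<in> pm.span \<pp>_basis" for k by (intro pm.span_base) (auto simp: in_p_def)
  then have "bracket (basis_vec x) (annihilating_vec p) \<in> pm.span \<pp>_basis"
    unfolding n bracket_H_annihilating_vec by (intro pm.span_scale pm.span_sum)
  moreover have "\<chi> (bracket (basis_vec x) (annihilating_vec p))
      = (of_int n + 1/2) * shift_op p (\<lambda>n. \<phi> (H n)) n"
    unfolding n bracket_H_annihilating_vec \<chi>.scale \<chi>.sum extends shift_op_conv_sum ..
  ultimately show ?thesis by (simp add: recurrence)
next
  case False
  then have "structure_const x (D m) = 0" for m using x
    by (cases x) (auto simp: in_p_def structure_const_simps)
  then have "bracket (basis_vec x) (annihilating_vec p) = 0"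
    by (simp add: annihilating_vec_def hv.bracket_right.sum hv.bracket_right.scale bracket_basis_vec
        del: pm_scale_single)
  then show ?thesis using module_hom.zero[OF \<chi>[unfolded linear_iff_module_hom]]
    by (simp add: pm.span_zero)
qed

lemma annihilating_vec_eq_scalar_mod_Wker:
  assumes irr: "W_irreducible \<phi>" and "\<phi> L = 0" and "p \<noteq> 0"
    and recurrence: "shift_op p (\<lambda>n. \<phi> (H n)) = 0"
  shows "linear_tens (annihilating_vec p) - l \<cdot> 1 \<in> Wker \<phi>"
proof -
  define f where "f x = (if x = D (degree p) then l / lead_coeff p else if in_p x then \<phi> x else 0)"
      for x
  interpret fld: vector_space "(*) :: complex \<Rightarrow> _" by (rule vector_space_field)
  interpret \<chi>: Vector_Spaces.linear pm_scale "(*)" "lin_ext (*) f" by (rule fld.linear_lin_ext)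
  let ?v = "annihilating_vec p" and ?\<chi> = "lin_ext (*) f"
  have \<chi>_p: "?\<chi> (basis_vec x) = \<phi> x" if "in_p x" for x
    using that by (auto simp: f_def in_p_def)
  have "?\<chi> ?v = (\<Sum>i\<le>degree p. coeff p i * f (D (int i)))"
    by (simp add: annihilating_vec_def \<chi>.sum)
  also have "\<dots> = (\<Sum>i\<le>degree p. if i = degree p then l else 0)"
    using \<open>p \<noteq> 0\<close> by (intro sum.cong) (auto simp: f_def in_p_def)
  finally have \<chi>_v: "?\<chi> ?v = l" by simp
  let ?S = "pm.span (insert ?v \<pp>_basis) \<inter> {z. ?\<chi> z = 0}"
  have "pm.span \<pp>_basis \<subseteq> pm.span (insert ?v \<pp>_basis)" by (intro pm.span_mono) auto
  then have "bracket x y \<in> ?S" if "x \<in> \<pp>_basis" "y \<in> \<pp>_basis" for x y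
    using that bracket_p_p[OF _ _ \<chi>.linear_axioms] \<chi>_p[of L] \<open>\<phi> L = 0\<close> by (auto simp: in_p_def)
  moreover have "bracket x ?v \<in> ?S" if "x \<in> \<pp>_basis" for x
    using that bracket_p_annihilating_vec[OF _ \<chi>.linear_axioms _ recurrence] \<chi>_p
      \<open>pm.span \<pp>_basis \<subseteq> pm.span (insert ?v \<pp>_basis)\<close> by (auto simp: in_p_def)
  moreover have "pm.subspace ?S" by (intro pm.subspace_inter pm.subspace_span \<chi>.subspace_kernel)
  ultimately have "bracket x y \<in> pm.span (insert ?v \<pp>_basis) \<and> ?\<chi> (bracket x y) = 0"
    if "x \<in> insert ?v \<pp>_basis" "y \<in> insert ?v \<pp>_basis" for x y
    using hv.bracket_insert_in_subspace[of ?S \<pp>_basis ?v x y] that by blast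
  then obtain S where S: "left_ideal S" "Wker \<phi> \<subseteq> S" "1 \<notin> S" "linear_tens ?v - ?\<chi> ?v \<cdot> 1 \<in> S"
    using ex_proper_left_ideal_of_character[OF \<chi>.linear_axioms, of "insert ?v \<pp>_basis" \<phi>] \<chi>_p
    by auto
  then have "S = Wker \<phi>" using irr unfolding W_irreducible_def by blast
  then show ?thesis using S(4) by (simp only: \<chi>_v)
qed

lemma recurrent_imp_not_irreducible:
  assumes "\<phi> L = 0" "recurrent (\<lambda>n. \<phi> (H n))"
  shows "\<not> W_irreducible \<phi>"
proof
  assume irr: "W_irreducible \<phi>"
  obtain p where "p \<noteq> 0" "shift_op p (\<lambda>n. \<phi> (H n)) = 0" using assms(2) by (auto simp: recurrent_def)
  then have "linear_tens (annihilating_vec p) - l \<cdot> 1 \<in> Wker \<phi>" for l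
    by (rule annihilating_vec_eq_scalar_mod_Wker[OF irr assms(1)])
  from pm.subspace_diff[OF left_ideal_imp_subspace[OF left_ideal_Wker] this[of 0] this[of 1]]
  have "1 \<in> Wker \<phi>" by simp
  then show False using irr left_ideal_eq_UNIV[OF left_ideal_Wker] by (simp add: W_irreducible_def)
qed

section \<open>The degree filtration\<close>

lemma commutator_relation_mult_in_Wker: "commutator_relation x y * b \<in> Wker \<phi>"
proof -
  have "1 * commutator_relation x y * b \<in> Wgens \<phi>" unfolding Wgens_eq by blast
  then show ?thesis using Wgens_subset_Wker by auto
qed

definition character_shift :: "(gen \<Rightarrow> complex) \<Rightarrow> gen \<Rightarrow> tens" where
  "character_shift \<phi> p = gvec p - \<phi> p \<cdot> 1"

lemma character_shift_in_Wker: "in_p p \<Longrightarrow> character_shift \<phi> p \<in> Wker \<phi>"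
  by (rule subsetD[OF Wgens_subset_Wker]) (auto simp: Wgens_eq character_shift_def)

lemma gvec_mult_eq: "gvec p * x = character_shift \<phi> p * x + \<phi> p \<cdot> x"
  by (simp add: character_shift_def left_diff_distrib pm_scale_mult_left)

lemma gvec_commute:
  "gvec x * (gvec y * z) = gvec y * (gvec x * z) + br x y * z + commutator_relation x y * z"
  by (simp add: commutator_relation_def algebra_simps)

definition D_word :: "int list \<Rightarrow> tens" where
  "D_word us = single (map D us) 1"

lemma D_word_Nil [simp]: "D_word [] = 1"
  by (simp add: D_word_def one_eq_single_Nil)

lemma D_word_Cons: "D_word (m # us) = gvec (D m) * D_word us"
  by (simp add: D_word_def gvec_def single_mult_single_word)

definition filtration :: "(gen \<Rightarrow> complex) \<Rightarrow> nat \<Rightarrow> tens set" where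
  "filtration \<phi> k = pm.span (Wker \<phi> \<union> {D_word us | us. length us < k})"

lemma subspace_Wker: "pm.subspace (Wker \<phi>)"
  by (rule left_ideal_imp_subspace[OF left_ideal_Wker])

lemma subspace_filtration: "pm.subspace (filtration \<phi> k)"
  by (simp add: filtration_def)

lemmas filtration_add = pm.subspace_add[OF subspace_filtration]
  and filtration_diff = pm.subspace_diff[OF subspace_filtration]
  and filtration_scale = pm.subspace_scale[OF subspace_filtration]
  and filtration_sum = pm.subspace_sum[OF subspace_filtration]
  and filtration_zero = pm.subspace_0[OF subspace_filtration]

lemma Wker_in_filtration: "x \<in> Wker \<phi> \<Longrightarrow> x \<in> filtration \<phi> k"
  by (simp add: filtration_def pm.span_base)

lemma D_word_in_filtration: "length us < k \<Longrightarrow> D_word us \<in> filtration \<phi> k"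
  by (auto simp: filtration_def intro: pm.span_base)

lemma filtration_mono: "j \<le> k \<Longrightarrow> filtration \<phi> j \<subseteq> filtration \<phi> k"
  unfolding filtration_def by (intro pm.span_mono) auto

lemma filtration_0: "filtration \<phi> 0 = Wker \<phi>"
  using subspace_Wker by (simp add: filtration_def)

lemma filtration_1: "x \<in> filtration \<phi> (Suc 0) \<longleftrightarrow> (\<exists>c. x - c \<cdot> 1 \<in> Wker \<phi>)"
proof -
  have "Wker \<phi> \<union> {D_word us | us. length us < Suc 0} = insert 1 (Wker \<phi>)" by force
  moreover have "pm.span (Wker \<phi>) = Wker \<phi>" using subspace_Wker by (simp only: pm.span_eq_iff)
  ultimately show ?thesis by (simp only: filtration_def pm.span_insert mem_Collect_eq)
qed

lemma mult_in_filtration: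
  assumes "x \<in> filtration \<phi> j" and "\<And>us. length us < j \<Longrightarrow> a * D_word us \<in> filtration \<phi> k"
  shows "a * x \<in> filtration \<phi> k"
proof -
  interpret Vector_Spaces.linear pm_scale pm_scale "\<lambda>x :: tens. a * x" by (rule linear_times_right)
  have "pm.subspace {x. a * x \<in> filtration \<phi> k}" using subspace_filtration
    by (rule subspace_linear_preimage)
  then have "filtration \<phi> j \<subseteq> {x. a * x \<in> filtration \<phi> k}"
    unfolding filtration_def[of \<phi> j] using assms(2) left_ideal_mult[OF left_ideal_Wker]
    by (intro pm.span_minimal) (auto intro: Wker_in_filtration)
  then show ?thesis using assms(1) by blast
qed

lemma gvec_D_mult_filtration: "x \<in> filtration \<phi> k \<Longrightarrow> gvec (D m) * x \<in> filtration \<phi> (Suc k)"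
  by (rule mult_in_filtration) (auto simp flip: D_word_Cons intro: D_word_in_filtration)

lemma gvec_D_mult_filtration_pred: "x \<in> filtration \<phi> (k - 1) \<Longrightarrow> gvec (D m) * x \<in> filtration \<phi> k"
  by (cases k) (auto simp: filtration_0 gvec_D_mult_filtration left_ideal_mult[OF left_ideal_Wker])

text \<open>The derivation of the symmetric algebra that extends the linear form \<open>d\<^sub>m \<mapsto> l m\<close>, lifted to
  words.\<close>
fun contract :: "(int \<Rightarrow> complex) \<Rightarrow> int list \<Rightarrow> tens" where
  "contract l [] = 0"
| "contract l (m # us) = l m \<cdot> D_word us + gvec (D m) * contract l us"

lemma contract_cong: "(\<And>m. m \<in> set us \<Longrightarrow> l m = l' m) \<Longrightarrow> contract l us = contract l' us"
  by (induction us) auto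

lemma contract_zero: "contract 0 us = 0"
  by (induction us) auto

lemma contract_add: "contract (l + l') us = contract l us + contract l' us"
  by (induction us) (auto simp: pm.scale_left_distrib distrib_left)

lemma contract_scale: "contract (fun_scale c l) us = c \<cdot> contract l us"
  by (induction us) (auto simp: pm.scale_right_distrib pm_scale_mult_right)

lemma contract_in_filtration: "contract l us \<in> filtration \<phi> (length us)"
  by (induction us)
    (auto intro!: filtration_zero filtration_add filtration_scale gvec_D_mult_filtration
      D_word_in_filtration)

definition bracket_value :: "(gen \<Rightarrow> complex) \<Rightarrow> gen \<Rightarrow> int \<Rightarrow> complex" where
  "bracket_value \<phi> p m = lin_ext (*) \<phi> (structure_const p (D m))"

lemma bracket_p_D:
  assumes "in_p p"
  obtains c q where "in_p q" "br p (D m) = c \<cdot> gvec q" "bracket_value \<phi> p m = c * \<phi> q"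
proof -
  obtain c q where "in_p q" "structure_const p (D m) = c \<cdot> basis_vec q"
  proof (cases "\<exists>n. p = H n")
    case True
    then obtain n where "p = H n" by blast
    then show ?thesis using that[of "H (m + n)" "of_int n + 1/2"]
      by (simp add: in_p_def structure_const_simps)
  next
    case False
    then have "structure_const p (D m) = 0" using assms
      by (cases p) (auto simp: in_p_def structure_const_simps)
    then show ?thesis using that[of C 0] by (simp add: in_p_def)
  qed
  moreover from this have "br p (D m) = c \<cdot> gvec q" "bracket_value \<phi> p m = c * \<phi> q"
    using vector_space.lin_ext_single[OF vector_space_field]
    by (simp_all add: br_eq_linear_tens linear_tens_def bracket_value_def)
  ultimately show ?thesis using that by blast
qed

lemma character_shift_mult_D_word_Cons:
  assumes "in_p p"
  obtains c q where "in_p q"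
    and "character_shift \<phi> p * D_word (m # us) - contract (bracket_value \<phi> p) (m # us)
      = gvec (D m) * (character_shift \<phi> p * D_word us - contract (bracket_value \<phi> p) us)
        + c \<cdot> (character_shift \<phi> q * D_word us) + commutator_relation p (D m) * D_word us"
proof -
  obtain c q where q: "in_p q" "br p (D m) = c \<cdot> gvec q" "bracket_value \<phi> p m = c * \<phi> q"
    using bracket_p_D[OF assms] by blast
  have "gvec p * D_word (m # us) = gvec (D m) * (gvec p * D_word us) + br p (D m) * D_word us
      + commutator_relation p (D m) * D_word us"
    unfolding D_word_Cons by (rule gvec_commute)
  then show ?thesis
    by (intro that[OF q(1), of c])
      (simp add: gvec_mult_eq[of p _ \<phi>] gvec_mult_eq[of q _ \<phi>] q pm_scale_mult_left
        pm_scale_mult_right D_word_Cons algebra_simps)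
qed

lemma in_filtration_if_symbol:
  assumes "x - contract l us \<in> filtration \<phi> (length us - 1)"
  shows "x \<in> filtration \<phi> (length us)"
proof -
  have "filtration \<phi> (length us - 1) \<subseteq> filtration \<phi> (length us)" by (rule filtration_mono) simp
  then have "x - contract l us + contract l us \<in> filtration \<phi> (length us)"
    using assms contract_in_filtration by (intro filtration_add) auto
  then show ?thesis by simp
qed

text \<open>On symbols, \<open>p - \<phi>(p)\<close> acts as the derivation \<open>d\<^sub>m \<mapsto> \<phi>([p, d\<^sub>m])\<close>.\<close>
lemma character_shift_mult_D_word:
  "in_p p \<Longrightarrow> character_shift \<phi> p * D_word us - contract (bracket_value \<phi> p) us
    \<in> filtration \<phi> (length us - 1)"
proof (induction us arbitrary: p)
  case Nil
  then show ?case using character_shift_in_Wker by (auto intro: Wker_in_filtration)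
next
  case (Cons m us)
  show ?case
  proof (rule character_shift_mult_D_word_Cons[OF Cons.prems, of \<phi> m us])
    fix c q
    assume "in_p q"
      and step: "character_shift \<phi> p * D_word (m # us) - contract (bracket_value \<phi> p) (m # us)
        = gvec (D m) * (character_shift \<phi> p * D_word us - contract (bracket_value \<phi> p) us)
          + c \<cdot> (character_shift \<phi> q * D_word us) + commutator_relation p (D m) * D_word us"
    then have "character_shift \<phi> q * D_word us \<in> filtration \<phi> (length us)"
      using Cons.IH in_filtration_if_symbol by blast
    then show ?thesis
      unfolding step using Cons
      by (intro filtration_add filtration_scale)
        (auto intro: gvec_D_mult_filtration_pred Wker_in_filtration commutator_relation_mult_in_Wker)
  qed
qed

lemma character_shift_mult_filtration:
  assumes "in_p p" "x \<in> filtration \<phi> k"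
  shows "character_shift \<phi> p * x \<in> filtration \<phi> (k - 1)"
proof (rule mult_in_filtration[OF assms(2)])
  fix us :: "int list"
  assume "length us < k"
  then have "filtration \<phi> (length us) \<subseteq> filtration \<phi> (k - 1)" by (intro filtration_mono) simp
  then show "character_shift \<phi> p * D_word us \<in> filtration \<phi> (k - 1)"
    using in_filtration_if_symbol[OF character_shift_mult_D_word[OF assms(1)]] by blast
qed

lemma gvec_p_mult_filtration: "in_p p \<Longrightarrow> x \<in> filtration \<phi> k \<Longrightarrow> gvec p * x \<in> filtration \<phi> k"
  using character_shift_mult_filtration[of p x \<phi> k] filtration_mono[of "k - 1" k]
  by (auto simp: gvec_mult_eq[of p x \<phi>] intro!: filtration_add filtration_scale)

lemma gvec_mult_filtration: "x \<in> filtration \<phi> k \<Longrightarrow> gvec g * x \<in> filtration \<phi> (Suc k)"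
proof (cases g)
  case (D m)
  then show "x \<in> filtration \<phi> k \<Longrightarrow> ?thesis" by (simp add: gvec_D_mult_filtration)
qed (use gvec_p_mult_filtration[of g x \<phi> k] filtration_mono[of k "Suc k"] in \<open>auto simp: in_p_def\<close>)

lemma filtration_exhaustive: "\<exists>k. x \<in> filtration \<phi> k"
proof -
  have word: "\<exists>k. single w 1 \<in> filtration \<phi> k" for w
  proof (induction w)
    case Nil
    show ?case using D_word_in_filtration[of "[]" 1] by (auto simp: one_eq_single_Nil)
  next
    case (Cons g w)
    then obtain k where "gvec g * single w 1 \<in> filtration \<phi> (Suc k)" using gvec_mult_filtration
      by blast
    then show ?case by (auto simp: gvec_def single_mult_single_word)
  qed
  have "pm.subspace {x. \<exists>k. x \<in> filtration \<phi> k}"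
  proof (rule pm.subspaceI)
    fix x y assume "x \<in> {x. \<exists>k. x \<in> filtration \<phi> k}" "y \<in> {x. \<exists>k. x \<in> filtration \<phi> k}"
    then obtain j k where "x \<in> filtration \<phi> j" "y \<in> filtration \<phi> k" by blast
    then have "x + y \<in> filtration \<phi> (max j k)"
      using filtration_mono[of j "max j k"] filtration_mono[of k "max j k"]
      by (intro filtration_add) auto
    then show "x + y \<in> {x. \<exists>k. x \<in> filtration \<phi> k}" by blast
  qed (auto intro: filtration_zero filtration_scale)
  then have "pm.span (range (\<lambda>w. single w 1)) \<subseteq> {x. \<exists>k. x \<in> filtration \<phi> k}"
    using word by (intro pm.span_minimal) auto
  then show ?thesis by (auto simp: span_range_single)
qed

lemma gvec_D_commute_mod_filtration:
  assumes "x \<in> filtration \<phi> k"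
  shows "gvec (D m) * (gvec (D n) * x) - gvec (D n) * (gvec (D m) * x) \<in> filtration \<phi> (Suc k)"
proof -
  define c :: complex where "c = (if m + n = 0 then of_int (m ^ 3 - m) / 12 else 0)"
  have "br (D m) (D n) * x = of_int (m - n) \<cdot> (gvec (D (m + n)) * x) + c \<cdot> (gvec C * x)"
    by (simp add: br_eq_linear_tens structure_const_simps linear_tens_def pm.lin_ext_add c_def
        distrib_right pm_scale_mult_left del: of_int_diff)
  also have "\<dots> \<in> filtration \<phi> (Suc k)" using assms
    by (intro filtration_add filtration_scale gvec_mult_filtration)
  finally have "br (D m) (D n) * x + commutator_relation (D m) (D n) * x \<in> filtration \<phi> (Suc k)"
    by (intro filtration_add Wker_in_filtration[OF commutator_relation_mult_in_Wker])
  then show ?thesis by (simp add: gvec_commute[of "D m" "D n" x])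
qed

section \<open>Irreducibility for non-recurrent characters\<close>

lemma euler_identity:
  assumes J: "finite J" and "set us \<subseteq> J"
  shows "(\<Sum>m\<in>J. gvec (D m) * contract (unit_fun m) us) - of_nat (length us) \<cdot> D_word us
    \<in> filtration \<phi> (length us)"
  using assms(2)
proof (induction us)
  case Nil
  then show ?case by (simp add: filtration_zero)
next
  case (Cons j us)
  have "(\<Sum>m\<in>J. gvec (D m) * (unit_fun m j \<cdot> D_word us))
      = (\<Sum>m\<in>J. if m = j then gvec (D j) * D_word us else 0)"
    by (intro sum.cong) auto
  also have "\<dots> = gvec (D j) * D_word us" using J Cons.prems by simp
  finally have "(\<Sum>m\<in>J. gvec (D m) * contract (unit_fun m) (j # us))
        - of_nat (length (j # us)) \<cdot> D_word (j # us)
      = gvec (D j) * ((\<Sum>m\<in>J. gvec (D m) * contract (unit_fun m) us) - of_nat (length us) \<cdot> D_word us)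
        + (\<Sum>m\<in>J. gvec (D m) * (gvec (D j) * contract (unit_fun m) us)
            - gvec (D j) * (gvec (D m) * contract (unit_fun m) us))"
    by (simp add: sum.distrib sum_subtractf sum_distrib_left distrib_left right_diff_distrib D_word_Cons
        pm.scale_left_distrib pm_scale_mult_right)
  also have "\<dots> \<in> filtration \<phi> (Suc (length us))"
    using Cons
    by (intro filtration_add gvec_D_mult_filtration filtration_sum
        gvec_D_commute_mod_filtration contract_in_filtration) auto
  finally show ?case by simp
qed

abbreviation character_shift_span :: "(gen \<Rightarrow> complex) \<Rightarrow> tens set" where
  "character_shift_span \<phi> \<equiv> pm.span {character_shift \<phi> p | p. in_p p}"

definition contracts :: "(gen \<Rightarrow> complex) \<Rightarrow> int set \<Rightarrow> tens \<Rightarrow> (int \<Rightarrow> complex) \<Rightarrow> bool" where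
  "contracts \<phi> J a l \<longleftrightarrow>
    (\<forall>us. set us \<subseteq> J \<longrightarrow> a * D_word us - contract l us \<in> filtration \<phi> (length us - 1))"

lemma contracts_zero: "contracts \<phi> J 0 0"
  by (simp add: contracts_def contract_zero filtration_zero)

lemma contracts_add: "contracts \<phi> J a l \<Longrightarrow> contracts \<phi> J b l' \<Longrightarrow> contracts \<phi> J (a + b) (l + l')"
  by (simp add: contracts_def contract_add distrib_right add_diff_add filtration_add)

lemma contracts_scale: "contracts \<phi> J a l \<Longrightarrow> contracts \<phi> J (c \<cdot> a) (fun_scale c l)"
  by (simp add: contracts_def contract_scale pm_scale_mult_left filtration_scale
      flip: pm.scale_right_diff_distrib)

lemma contracts_character_shift:
  assumes "in_p p" "\<forall>m\<in>J. l m = bracket_value \<phi> p m"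
  shows "contracts \<phi> J (character_shift \<phi> p) l"
proof -
  have "contract l us = contract (bracket_value \<phi> p) us" if "set us \<subseteq> J" for us
    using assms(2) that by (intro contract_cong) auto
  then show ?thesis using character_shift_mult_D_word[OF assms(1)] by (simp add: contracts_def)
qed

lemma ex_contracting_operator_if_in_span:
  assumes "l \<in> fn.span {l. \<exists>p. in_p p \<and> (\<forall>m\<in>J. l m = bracket_value \<phi> p m)}"
  shows "\<exists>a\<in>character_shift_span \<phi>. contracts \<phi> J a l"
proof -
  let ?T = "{l. \<exists>a\<in>character_shift_span \<phi>. contracts \<phi> J a l}"
  have "fn.subspace ?T"
  proof (rule fn.subspaceI)
    show "0 \<in> ?T" using contracts_zero pm.span_zero by blast
    show "l + l' \<in> ?T" if "l \<in> ?T" "l' \<in> ?T" for l l'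
      using that contracts_add pm.span_add by blast
    show "fun_scale c l \<in> ?T" if "l \<in> ?T" for c l
      using that contracts_scale pm.span_scale by blast
  qed
  moreover have "character_shift \<phi> p \<in> character_shift_span \<phi>" if "in_p p" for p
    using that by (auto intro: pm.span_base)
  then have "{l. \<exists>p. in_p p \<and> (\<forall>m\<in>J. l m = bracket_value \<phi> p m)} \<subseteq> ?T"
    using contracts_character_shift by blast
  ultimately show ?thesis using assms fn.span_minimal by blast
qed

lemma of_int_plus_half_neq_0: "of_int n + 1/2 \<noteq> (0 :: complex)"
proof
  assume "of_int n + 1/2 = (0 :: complex)"
  then have "of_int (2 * n + 1) = (0 :: complex)" by (simp add: field_simps)
  then have "2 * n + 1 = 0" by (simp only: of_int_eq_0_iff)
  then show False by presburger
qed

lemma bracket_value_H: "bracket_value \<phi> (H n) m = (of_int n + 1/2) * \<phi> (H (m + n))"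
  using vector_space.lin_ext_single[OF vector_space_field]
  by (simp add: bracket_value_def structure_const_simps)

lemma unit_fun_in_span_bracket_values:
  assumes not_recurrent: "\<not> recurrent (\<lambda>n. \<phi> (H n))" and J: "finite J" "m \<in> J"
  shows "unit_fun m \<in> fn.span {l. \<exists>p. in_p p \<and> (\<forall>i\<in>J. l i = bracket_value \<phi> p i)}"
proof -
  define F where "F = range (\<lambda>n i. if i \<in> J then bracket_value \<phi> (H n) i else 0)"
  have "unit_fun m \<in> fn.span F"
  proof (rule supported_in_span_if_no_annihilator[OF J(1)])
    fix c :: "int \<Rightarrow> complex"
    assume c: "(\<Sum>i\<in>J. c i * f i) = 0" if "f \<in> F" for f
    have "(\<Sum>i\<in>J. c i * \<phi> (H (i + n))) = 0" for n
    proof -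
      have "(of_int n + 1/2) * (\<Sum>i\<in>J. c i * \<phi> (H (i + n)))
          = (\<Sum>i\<in>J. c i * (if i \<in> J then bracket_value \<phi> (H n) i else 0))"
        by (simp add: bracket_value_H sum_distrib_left mult.left_commute)
      also have "\<dots> = 0" by (rule c) (auto simp: F_def)
      finally show ?thesis using of_int_plus_half_neq_0 by simp
    qed
    then show "\<forall>i\<in>J. c i = 0"
      using recurrent_if_annihilated[OF J(1), of _ c "\<lambda>n. \<phi> (H n)"] not_recurrent by blast
  qed (use J(2) in \<open>auto simp: F_def\<close>)
  moreover have "F \<subseteq> {l. \<exists>p. in_p p \<and> (\<forall>i\<in>J. l i = bracket_value \<phi> p i)}"
    by (auto simp: F_def in_p_def intro!: exI[of _ "H _"])
  ultimately show ?thesis using fn.span_mono by blast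
qed

definition whittaker_vector :: "(gen \<Rightarrow> complex) \<Rightarrow> tens \<Rightarrow> bool" where
  "whittaker_vector \<phi> x \<longleftrightarrow> (\<forall>p. in_p p \<longrightarrow> character_shift \<phi> p * x \<in> Wker \<phi>)"

lemma whittaker_vector_character_shift_span:
  assumes "whittaker_vector \<phi> x" "a \<in> character_shift_span \<phi>"
  shows "a * x \<in> Wker \<phi>"
proof -
  interpret Vector_Spaces.linear pm_scale pm_scale "\<lambda>a :: tens. a * x" by (rule linear_times_left)
  have "character_shift_span \<phi> \<subseteq> {a. a * x \<in> Wker \<phi>}"
    using assms(1) subspace_linear_preimage[OF subspace_Wker]
    by (intro pm.span_minimal) (auto simp: whittaker_vector_def)
  then show ?thesis using assms(2) by blast
qed

lemma ex_euler_operator: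
  assumes not_recurrent: "\<not> recurrent (\<lambda>n. \<phi> (H n))" and J: "finite J"
  shows "\<exists>E. (\<forall>x. whittaker_vector \<phi> x \<longrightarrow> E * x \<in> Wker \<phi>) \<and>
    (\<forall>us. set us \<subseteq> J \<longrightarrow> E * D_word us - of_nat (length us) \<cdot> D_word us \<in> filtration \<phi> (length us))"
proof -
  have "\<forall>m\<in>J. \<exists>a. a \<in> character_shift_span \<phi> \<and> contracts \<phi> J a (unit_fun m)"
    using ex_contracting_operator_if_in_span unit_fun_in_span_bracket_values[OF assms] by blast
  from bchoice[OF this] obtain a
    where a: "\<forall>m\<in>J. a m \<in> character_shift_span \<phi> \<and> contracts \<phi> J (a m) (unit_fun m)"
    by (rule exE)
  define E where "E = (\<Sum>m\<in>J. gvec (D m) * a m)"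
  have "E * x \<in> Wker \<phi>" if x: "whittaker_vector \<phi> x" for x
    unfolding E_def sum_distrib_right mult.assoc
  proof (rule pm.subspace_sum[OF subspace_Wker])
    show "gvec (D m) * (a m * x) \<in> Wker \<phi>" if "m \<in> J" for m
      using a that whittaker_vector_character_shift_span[OF x]
      by (intro left_ideal_mult[OF left_ideal_Wker, of "a m * x"]) blast
  qed
  moreover have "E * D_word us - of_nat (length us) \<cdot> D_word us \<in> filtration \<phi> (length us)"
    if us: "set us \<subseteq> J" for us
  proof -
    have "E * D_word us - of_nat (length us) \<cdot> D_word us
        = (\<Sum>m\<in>J. gvec (D m) * (a m * D_word us - contract (unit_fun m) us))
          + ((\<Sum>m\<in>J. gvec (D m) * contract (unit_fun m) us) - of_nat (length us) \<cdot> D_word us)"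
      by (simp add: E_def sum_distrib_right mult.assoc right_diff_distrib sum_subtractf)
    also have "\<dots> \<in> filtration \<phi> (length us)"
      using us a
      by (intro filtration_add filtration_sum gvec_D_mult_filtration_pred euler_identity J)
        (auto simp: contracts_def)
    finally show ?thesis .
  qed
  ultimately show ?thesis by blast
qed

lemma ex_finite_letters:
  assumes "x \<in> filtration \<phi> k"
  shows "\<exists>J. finite J \<and> x \<in> pm.span (Wker \<phi> \<union> {D_word us | us. length us < k \<and> set us \<subseteq> J})"
proof -
  obtain T r where T: "finite T" "T \<subseteq> Wker \<phi> \<union> {D_word us | us. length us < k}"
      and x: "x = (\<Sum>a\<in>T. r a \<cdot> a)"
    using assms unfolding filtration_def pm.span_explicit by blast
  define J where "J = D -` (\<Union>a\<in>T. \<Union>w\<in>keys a. set w)"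
  have "finite J" unfolding J_def using T(1) by (intro finite_vimageI) (auto simp: inj_def)
  moreover have "set us \<subseteq> J" if "D_word us \<in> T" for us
  proof -
    have "map D us \<in> keys (D_word us)" by (simp add: D_word_def)
    then show ?thesis using that unfolding J_def by fastforce
  qed
  then have "T \<subseteq> Wker \<phi> \<union> {D_word us | us. length us < k \<and> set us \<subseteq> J}" using T(2) by blast
  then have "x \<in> pm.span (Wker \<phi> \<union> {D_word us | us. length us < k \<and> set us \<subseteq> J})"
    unfolding x by (intro pm.span_sum pm.span_scale pm.span_base) blast
  ultimately show ?thesis by blast
qed

lemma whittaker_vector_lowers_degree:
  assumes not_recurrent: "\<not> recurrent (\<lambda>n. \<phi> (H n))"
    and x: "whittaker_vector \<phi> x" "x \<in> filtration \<phi> (Suc k)" and "k \<noteq> 0"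
  shows "x \<in> filtration \<phi> k"
proof -
  obtain J where J: "finite J" "x \<in> pm.span (Wker \<phi> \<union> {D_word us | us. length us < Suc k \<and> set us \<subseteq> J})"
    using ex_finite_letters[OF x(2)] by blast
  obtain E where E: "\<And>x. whittaker_vector \<phi> x \<Longrightarrow> E * x \<in> Wker \<phi>"
    and euler: "\<And>us. set us \<subseteq> J \<Longrightarrow>
      E * D_word us - of_nat (length us) \<cdot> D_word us \<in> filtration \<phi> (length us)"
    using ex_euler_operator[OF not_recurrent J(1)] by blast
  interpret Vector_Spaces.linear pm_scale pm_scale "\<lambda>y :: tens. E * y - of_nat k \<cdot> y"
    by unfold_locales (simp_all add: pm_scale_mult_right algebra_simps)
  have "E * D_word us - of_nat k \<cdot> D_word us \<in> filtration \<phi> k"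
    if us: "length us < Suc k" "set us \<subseteq> J" for us
  proof (cases "length us = k")
    case False
    then have "D_word us \<in> filtration \<phi> k" using us(1) by (intro D_word_in_filtration) simp
    moreover have "E * D_word us - of_nat (length us) \<cdot> D_word us \<in> filtration \<phi> k"
      using euler[OF us(2)] filtration_mono[of "length us" k] us(1) by auto
    ultimately have "(E * D_word us - of_nat (length us) \<cdot> D_word us)
        + (of_nat (length us) - of_nat k) \<cdot> D_word us \<in> filtration \<phi> k"
      by (intro filtration_add filtration_scale)
    then show ?thesis by (simp add: pm.scale_left_diff_distrib)
  qed (use euler us in blast)
  moreover have "E * y - of_nat k \<cdot> y \<in> filtration \<phi> k" if "y \<in> Wker \<phi>" for y
    using that
    by (intro filtration_diff filtration_scale Wker_in_filtration left_ideal_mult[OF left_ideal_Wker])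
  ultimately have "pm.span (Wker \<phi> \<union> {D_word us | us. length us < Suc k \<and> set us \<subseteq> J})
      \<subseteq> {y. E * y - of_nat k \<cdot> y \<in> filtration \<phi> k}"
    by (intro pm.span_minimal subspace_linear_preimage subspace_filtration) auto
  then have "E * x - of_nat k \<cdot> x \<in> filtration \<phi> k" using J(2) by blast
  from filtration_diff[OF Wker_in_filtration[OF E[OF x(1)]] this]
  have "of_nat k \<cdot> x \<in> filtration \<phi> k" by simp
  then show ?thesis using pm.subspace_scale_iff[OF subspace_filtration, of "of_nat k" x] \<open>k \<noteq> 0\<close>
    by simp
qed

lemma submodule_meets_degree_0:
  assumes not_recurrent: "\<not> recurrent (\<lambda>n. \<phi> (H n))"
    and S: "left_ideal S" "Wker \<phi> \<subseteq> S" and x: "x \<in> S" "x \<notin> Wker \<phi>" "x \<in> filtration \<phi> k"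
  shows "1 \<in> S"
  using x
proof (induction k arbitrary: x)
  case 0
  then show ?case by (simp add: filtration_0)
next
  case (Suc k)
  show ?case
  proof (cases "whittaker_vector \<phi> x")
    case False
    then obtain p where p: "in_p p" "character_shift \<phi> p * x \<notin> Wker \<phi>"
      by (auto simp: whittaker_vector_def)
    then show ?thesis
      using Suc.IH[OF left_ideal_mult[OF S(1) Suc.prems(1)]]
        character_shift_mult_filtration[OF p(1) Suc.prems(3)]
      by simp
  next
    case True
    show ?thesis
    proof (cases "k = 0")
      case False
      then show ?thesis
        using Suc.IH Suc.prems whittaker_vector_lowers_degree[OF not_recurrent True] by blast
    next
      case True
      then obtain c where c: "x - c \<cdot> 1 \<in> Wker \<phi>"
        using Suc.prems(3) by (auto simp: filtration_1)
      then have "x - (x - c \<cdot> 1) \<in> S"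
        by (rule pm.subspace_diff[OF left_ideal_imp_subspace[OF S(1)] Suc.prems(1) subsetD[OF S(2)]])
      moreover have "c \<noteq> 0" using c Suc.prems(2) by auto
      ultimately show ?thesis
        using pm.subspace_scale_iff[OF left_ideal_imp_subspace[OF S(1)], of c 1] by simp
    qed
  qed
qed

lemma not_recurrent_imp_irreducible:
  assumes "\<phi> L = 0" "\<not> recurrent (\<lambda>n. \<phi> (H n))"
  shows "W_irreducible \<phi>"
  unfolding W_irreducible_def
proof (intro conjI allI impI)
  show "Wker \<phi> \<noteq> UNIV" using assms(1) by (rule Wker_neq_UNIV)
  fix S assume S: "left_ideal S \<and> Wker \<phi> \<subseteq> S"
  show "S = Wker \<phi> \<or> S = UNIV"
  proof (cases "S \<subseteq> Wker \<phi>")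
    case False
    then obtain x where "x \<in> S" "x \<notin> Wker \<phi>" by blast
    then have "1 \<in> S"
      using submodule_meets_degree_0[OF assms(2)] S filtration_exhaustive by blast
    then show ?thesis using S left_ideal_eq_UNIV by blast
  qed (use S in blast)
qed

theorem theorem4p3:
  fixes \<phi> :: "gen \<Rightarrow> complex"
  assumes hom: "\<phi> L = 0"
    and nonzero: "\<exists>n. \<phi> (H n) \<noteq> 0"
  shows "W_irreducible \<phi> \<longleftrightarrow> \<not> exp_polynomial \<phi>"
proof -
  have "exp_polynomial \<phi> \<longleftrightarrow> exp_poly_seq (\<lambda>n. \<phi> (H n))"
    by (simp add: exp_polynomial_def exp_poly_seq_def)
  also have "\<dots> \<longleftrightarrow> recurrent (\<lambda>n. \<phi> (H n))"
    by (rule exp_poly_seq_iff_recurrent)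
  finally show ?thesis
    using recurrent_imp_not_irreducible not_recurrent_imp_irreducible hom by blast
qed

end
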